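(* Let $\varphi\in L^1(0,\infty)$, and let $\mathcal H_\varphi$ be the Hausdorff operator generated by $\varphi$, $\mathcal H_\varphi f(x)=\int_0^\infty f\left(\frac{x}{t}\right)\frac{\varphi(t)}{t}\,dt$. Then $\mathcal H_\varphi$ is bounded on $H^1(\mathbb R)$, and moreover $$\left|\int_0^\infty \varphi(t)\,dt\right|\leq \|\mathcal H_\varphi\|_{H^1(\mathbb R)\to H^1(\mathbb R)}\leq \int_0^\infty |\varphi(t)|\,dt.$$
   Context: Fix an arbitrary function $\Phi$ in the Schwartz space $\mathcal S(\mathbb R)$ with $\int_{\mathbb R}\Phi(x)\,dx\neq 0$, and set $\Phi_t(x)=t^{-1}\Phi(x/t)$ for $t>0$. For $f\in L^1(\mathbb R)$ (functions are allowed to be complex-valued), the smooth maximal function is $M_\Phi f(x)=\sup_{t>0}|f*\Phi_t(x)|$, $x\in\mathbb R$. The real Hardy space $H^1(\mathbb R)$ is the space of all $f\in L^1(\mathbb R)$ with $\|f\|_{H^1(\mathbb R)}:=\|M_\Phi f\|_{L^1(\mathbb R)}<\infty$. The space $H^1(\mathbb R)$ does not depend on the choice of $\Phi$ (the norm does). $\|T\|_{H^1(\mathbb R)\to H^1(\mathbb R)}$ denotes the operator norm of $T$ on $(H^1(\mathbb R),\|\cdot\|_{H^1(\mathbb R)})$. *)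

theory Defs
  imports "HOL-Analysis.Analysis"
begin

text \<open>
  Elements of \<open>L\<^sup>1\<close> and \<open>H\<^sup>1\<close> are represented by complex-valued Lebesgue measurable functions;
  identities between elements of these spaces are therefore stated almost everywhere.
  Maximal functions, Hardy norms and operator norms take values in \<^typ>\<open>ennreal\<close>.
\<close>

text \<open>\<open>D n\<close> is the \<open>n\<close>-th derivative; the existence of all \<open>D n\<close> is smoothness.\<close>

definition schwartz :: "(real \<Rightarrow> complex) \<Rightarrow> bool" where
  "schwartz \<Phi> \<longleftrightarrow>
     (\<exists>D :: nat \<Rightarrow> real \<Rightarrow> complex. D 0 = \<Phi> \<and>
        (\<forall>n x. (D n has_vector_derivative D (Suc n) x) (at x)) \<and>
        (\<forall>k n. \<exists>C. \<forall>x. \<bar>x\<bar> ^ k * cmod (D n x) \<le> C))"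

definition dilate :: "real \<Rightarrow> (real \<Rightarrow> complex) \<Rightarrow> real \<Rightarrow> complex" where
  "dilate t \<Phi> x = \<Phi> (x / t) / of_real t"

definition convolve :: "(real \<Rightarrow> complex) \<Rightarrow> (real \<Rightarrow> complex) \<Rightarrow> real \<Rightarrow> complex" where
  "convolve f g x = (LINT y|lebesgue. f (x - y) * g y)"

definition smooth_maximal :: "(real \<Rightarrow> complex) \<Rightarrow> (real \<Rightarrow> complex) \<Rightarrow> real \<Rightarrow> ennreal" where
  "smooth_maximal \<Phi> f x = (SUP t\<in>{0<..}. ennreal (cmod (convolve f (dilate t \<Phi>) x)))"

definition H1_norm :: "(real \<Rightarrow> complex) \<Rightarrow> (real \<Rightarrow> complex) \<Rightarrow> ennreal" where
  "H1_norm \<Phi> f = (\<integral>\<^sup>+ x. smooth_maximal \<Phi> f x \<partial>lebesgue)"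

definition H1 :: "(real \<Rightarrow> complex) \<Rightarrow> (real \<Rightarrow> complex) set" where
  "H1 \<Phi> = {f. integrable lebesgue f \<and> H1_norm \<Phi> f < \<infinity>}"

text \<open>
  Compatibility with almost everywhere equality is not listed separately: it follows from
  linearity and the norm bound, as \<open>H1_norm \<Phi> f = 0\<close> forces \<open>f = 0\<close> almost everywhere
  when \<open>\<integral>\<Phi> \<noteq> 0\<close>.
\<close>

definition bounded_on_H1 ::
    "(real \<Rightarrow> complex) \<Rightarrow> ((real \<Rightarrow> complex) \<Rightarrow> real \<Rightarrow> complex) \<Rightarrow> bool" where
  "bounded_on_H1 \<Phi> T \<longleftrightarrow>
     (\<forall>f\<in>H1 \<Phi>. T f \<in> H1 \<Phi>) \<and>
     (\<forall>f\<in>H1 \<Phi>. \<forall>g\<in>H1 \<Phi>. AE x in lebesgue. T (\<lambda>y. f y + g y) x = T f x + T g x) \<and>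
     (\<forall>c. \<forall>f\<in>H1 \<Phi>. AE x in lebesgue. T (\<lambda>y. c * f y) x = c * T f x) \<and>
     (\<exists>C::real. C \<ge> 0 \<and> (\<forall>f\<in>H1 \<Phi>. H1_norm \<Phi> (T f) \<le> ennreal C * H1_norm \<Phi> f))"

definition H1_opnorm ::
    "(real \<Rightarrow> complex) \<Rightarrow> ((real \<Rightarrow> complex) \<Rightarrow> real \<Rightarrow> complex) \<Rightarrow> ennreal" where
  "H1_opnorm \<Phi> T = (SUP f\<in>{f \<in> H1 \<Phi>. H1_norm \<Phi> f \<le> 1}. H1_norm \<Phi> (T f))"

text \<open>
  For \<open>f \<in> L\<^sup>1\<close> and \<open>\<phi> \<in> L\<^sup>1(0,\<infinity>)\<close> the integral converges absolutely for almost every \<open>x\<close>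
  (Tonelli); on the exceptional null set the Bochner integral has the value \<open>0\<close>, which affects
  neither the class of the result nor its Hardy norm.
\<close>

definition hausdorff_op :: "(real \<Rightarrow> complex) \<Rightarrow> (real \<Rightarrow> complex) \<Rightarrow> real \<Rightarrow> complex" where
  "hausdorff_op \<phi> f x = (LINT t:{0<..}|lebesgue. f (x / t) * (\<phi> t / of_real t))"

end

theory Submission
  imports Defs "HOL-Probability.Sinc_Integral"
begin

text \<open>
  Write \<open>D\<^sub>t f(x) = f(x/t)/t\<close>, so that \<open>H\<^sub>\<phi> f = \<integral> \<phi>(t) D\<^sub>t f dt\<close> is an average of \<open>L\<^sup>1\<close>-normalised dilates
  of \<open>f\<close>. Since \<open>(D\<^sub>t f) * \<Phi>\<^sub>r = D\<^sub>t (f * \<Phi>\<^bsub>r/t\<^esub>)\<close>, and the maximal function ranges over all scales \<open>r\<close>,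
  every \<open>D\<^sub>t\<close> is an isometry of \<open>H\<^sup>1\<close>. The upper bound is therefore Minkowski's inequality: by Fubini
  \<open>M\<^sub>\<Phi>(H\<^sub>\<phi> f) \<le> \<integral> |\<phi>(t)| D\<^sub>t(M\<^sub>\<Phi> f) dt\<close> (\<open>smooth_maximal_borel_hausdorff_le\<close>), and integrating in \<open>x\<close>
  with Tonelli gives \<open>H1_norm_borel_hausdorff_le\<close>.

  For the lower bound one needs nonzero elements of \<open>H\<^sup>1\<close> that are almost invariant under all
  dilations, because \<open>H\<^sub>\<phi>\<close> multiplies an invariant function by \<open>I = \<integral> \<phi>\<close>. The dilations form a copy of
  the multiplicative group \<open>(0,\<infinity>)\<close>, which is amenable with Haar measure \<open>dt/t\<close>, so such elements arise
  by averaging a fixed one over a long interval: put \<open>\<psi>\<^sub>n(t) = 1/t\<close> on \<open>[1, e\<^sup>n]\<close> and \<open>f\<^sub>n = H\<^bsub>\<psi>\<^sub>n\<^esub> a\<close> with the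
  atom \<open>a = sgn\<close> on \<open>[-1,1]\<close>. Two estimates compete.

  \<^item> The norm of \<open>f\<^sub>n\<close> grows at least linearly (\<open>H1_norm_test_fun_ge\<close>): \<open>f\<^sub>n(x) = 1/x - e\<^bsup>-n\<^esup>\<close> on
    \<open>(1, e\<^sup>n)\<close>, and \<open>M\<^sub>\<Phi> f \<ge> |\<integral> \<Phi>| |f|\<close> at points of continuity, because \<open>f * \<Phi>\<^sub>t\<close> tends to \<open>f \<integral> \<Phi>\<close> as
    \<open>t\<close> tends to \<open>0\<close>. This is where \<open>\<integral> \<Phi> \<noteq> 0\<close> enters.

  \<^item> The defect \<open>H\<^sub>\<phi> f\<^sub>n - I f\<^sub>n\<close> has norm \<open>o(n)\<close>. Hausdorff operators compose by multiplicative
    convolution of their kernels, \<open>H\<^sub>\<phi> H\<^sub>\<psi> = H\<^sub>\<chi>\<close> with \<open>\<chi> = H\<^sub>\<phi> \<psi>\<close> (\<open>borel_hausdorff_compose\<close>), so the defect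
    is \<open>H\<^sub>\<theta> a\<close> with \<open>\<theta> = H\<^sub>\<phi> \<psi>\<^sub>n - I \<psi>\<^sub>n\<close>. The upper bound applied to \<open>\<theta>\<close> reduces matters to
    \<open>\<parallel>\<theta>\<parallel>\<^sub>1 \<le> \<integral> |\<phi>(t)| min (2 |ln t|) (2 n) dt\<close> (\<open>log_kernel_defect\<close>), and this is \<open>o(n)\<close> by dominated
    convergence (\<open>log_kernel_defect_sublinear\<close>).

  Hence \<open>|I| \<parallel>f\<^sub>n\<parallel> \<le> \<parallel>H\<^sub>\<phi>\<parallel> \<parallel>f\<^sub>n\<parallel> + o(n)\<close>, and dividing by \<open>n\<close> gives \<open>|I| \<le> \<parallel>H\<^sub>\<phi>\<parallel>\<close>. The atom has finite
  \<open>H\<^sup>1\<close> norm (\<open>H1_norm_odd_atom_finite\<close>) by the classical cancellation estimate.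
\<close>

section \<open>Borel representatives and exchange of integrals\<close>

text \<open>
  Product measurability and Tonelli's theorem are used on the Borel sigma-algebra, where maps such as
  \<open>(x, t) \<mapsto> f (x / t)\<close> are measurable. The lemmas of this section replace Lebesgue measurable functions
  by Borel ones.
\<close>
lemma borel_measurable_lebesgue_AE:
  fixes f g :: "real \<Rightarrow> 'a :: {banach, second_countable_topology}"
  assumes g: "g \<in> borel_measurable borel" and ae: "AE x in lborel. f x = g x"
  shows "f \<in> borel_measurable lebesgue"
proof (rule measurableI)
  fix A :: "'a set" assume A: "A \<in> sets borel"
  have "AE x in lebesgue. f x = g x"
    using ae by (rule AE_completion)
  then have ae': "AE x in lebesgue. x \<in> g -` A \<inter> space lebesgue \<longleftrightarrow> x \<in> f -` A \<inter> space lebesgue"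
    by eventually_elim auto
  have "g \<in> borel_measurable lebesgue"
    using g by (intro measurable_completion) simp
  then have "g -` A \<inter> space lebesgue \<in> sets lebesgue"
    using A by (rule measurable_sets)
  then show "f -` A \<inter> space lebesgue \<in> sets lebesgue"
    by (rule completion.in_sets_AE[OF ae']) auto
qed simp

lemma lebesgue_integral_AE_borel:
  fixes f g :: "real \<Rightarrow> 'a :: {banach, second_countable_topology}"
  assumes g[measurable]: "g \<in> borel_measurable borel" and ae: "AE x in lborel. f x = g x"
  shows "integral\<^sup>L lebesgue f = integral\<^sup>L lborel g"
    and "integrable lebesgue f \<longleftrightarrow> integrable lborel g"
proof -
  have f: "f \<in> borel_measurable lebesgue"
    by (rule borel_measurable_lebesgue_AE) fact+
  have g': "g \<in> borel_measurable lebesgue"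
    by (intro measurable_completion) simp
  have ae': "AE x in lebesgue. f x = g x"
    using ae by (rule AE_completion)
  show "integral\<^sup>L lebesgue f = integral\<^sup>L lborel g"
    using integral_cong_AE[OF f g' ae'] by (simp add: integral_completion)
  show "integrable lebesgue f \<longleftrightarrow> integrable lborel g"
    using integrable_cong_AE[OF f g' ae'] by (simp add: integrable_completion)
qed

lemma integrable_borel_representative:
  fixes f :: "real \<Rightarrow> complex"
  assumes f: "integrable lebesgue f"
  obtains g where "integrable lborel g" "AE x in lborel. f x = g x"
proof -
  have "(\<lambda>x. Re (f x)) \<in> borel_measurable lebesgue" "(\<lambda>x. Im (f x)) \<in> borel_measurable lebesgue"
    using borel_measurable_integrable[OF f] by measurable
  then obtain u v where [measurable]: "u \<in> borel_measurable borel" "v \<in> borel_measurable borel"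
    and uv: "AE x in lborel. Re (f x) = u x" "AE x in lborel. Im (f x) = v x"
    by (auto dest!: completion_ex_borel_measurable_real)
  define g where "g x = Complex (u x) (v x)" for x
  have g: "g \<in> borel_measurable borel"
    unfolding g_def Complex_eq by measurable
  have ae: "AE x in lborel. f x = g x"
    using uv by eventually_elim (simp add: g_def complex_eq_iff)
  show thesis
    by (rule that[OF _ ae]) (use f lebesgue_integral_AE_borel(2)[OF g ae] in simp)
qed

lemma lborel_integral_swap:
  fixes F :: "real \<Rightarrow> real \<Rightarrow> complex"
  assumes F[measurable]: "case_prod F \<in> borel_measurable (borel \<Otimes>\<^sub>M borel)"
    and fin: "(\<integral>\<^sup>+x. \<integral>\<^sup>+y. ennreal (cmod (F x y)) \<partial>lborel \<partial>lborel) < \<infinity>"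
  shows "(LINT x|lborel. LINT y|lborel. F x y) = (LINT y|lborel. LINT x|lborel. F x y)"
    and "integrable lborel (\<lambda>x. LINT y|lborel. F x y)"
    and "integrable lborel (\<lambda>y. LINT x|lborel. F x y)"
    and "AE x in lborel. integrable lborel (\<lambda>y. F x y)"
    and "AE y in lborel. integrable lborel (\<lambda>x. F x y)"
proof -
  have *: "integrable (lborel \<Otimes>\<^sub>M lborel) (case_prod F)"
  proof (rule integrableI_bounded)
    show "case_prod F \<in> borel_measurable (lborel \<Otimes>\<^sub>M lborel)" using F by measurable
    have "(\<integral>\<^sup>+p. ennreal (cmod (case_prod F p)) \<partial>(lborel \<Otimes>\<^sub>M lborel)) =
        (\<integral>\<^sup>+x. \<integral>\<^sup>+y. ennreal (cmod (F x y)) \<partial>lborel \<partial>lborel)"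
      by (subst lborel.nn_integral_fst[symmetric]) auto
    then show "(\<integral>\<^sup>+p. ennreal (cmod (case_prod F p)) \<partial>(lborel \<Otimes>\<^sub>M lborel)) < \<infinity>"
      using fin by simp
  qed
  show "(LINT x|lborel. LINT y|lborel. F x y) = (LINT y|lborel. LINT x|lborel. F x y)"
    using lborel_pair.Fubini_integral[OF *] by simp
  show "integrable lborel (\<lambda>x. LINT y|lborel. F x y)"
    using lborel_pair.integrable_fst[OF *] by simp
  show "integrable lborel (\<lambda>y. LINT x|lborel. F x y)"
    using lborel_pair.integrable_snd[OF *] by simp
  show "AE x in lborel. integrable lborel (\<lambda>y. F x y)"
    using lborel_pair.AE_integrable_fst[OF *] by simp
  show "AE y in lborel. integrable lborel (\<lambda>x. F x y)"
    using lborel_pair.AE_integrable_snd[OF *] by simp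
qed

section \<open>Hausdorff operators with Borel kernels\<close>

text \<open>
  Kernels on \<open>(0,\<infinity>)\<close> are extended by zero to the whole line, so that all integrals are over \<open>\<real>\<close>.
\<close>
definition dilation_kernel :: "(real \<Rightarrow> complex) \<Rightarrow> bool" where
  "dilation_kernel \<phi> \<longleftrightarrow> integrable lborel \<phi> \<and> (\<forall>t\<le>0. \<phi> t = 0)"

definition borel_hausdorff :: "(real \<Rightarrow> complex) \<Rightarrow> (real \<Rightarrow> complex) \<Rightarrow> real \<Rightarrow> complex" where
  "borel_hausdorff \<phi> f x = (LINT t|lborel. f (x / t) * (\<phi> t / of_real t))"

lemma dilation_kernelD:
  assumes "dilation_kernel \<phi>"
  shows "integrable lborel \<phi>" "\<phi> \<in> borel_measurable borel" "t \<le> 0 \<Longrightarrow> \<phi> t = 0"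
    "(\<integral>\<^sup>+t. ennreal (cmod (\<phi> t)) \<partial>lborel) < \<infinity>"
  using assms by (auto simp: dilation_kernel_def dest: borel_measurable_integrable
    simp: integrable_iff_bounded)

lemma nn_integral_dilate:
  fixes F :: "real \<Rightarrow> ennreal"
  assumes [measurable]: "F \<in> borel_measurable borel" and t: "t > 0"
  shows "(\<integral>\<^sup>+x. F (x / t) * ennreal (1 / t) \<partial>lborel) = (\<integral>\<^sup>+x. F x \<partial>lborel)"
proof -
  have "(\<integral>\<^sup>+x. F (x / t) * ennreal (1 / t) \<partial>lborel) = (\<integral>\<^sup>+x. F (x / t) \<partial>lborel) * ennreal (1 / t)"
    by (subst nn_integral_multc) auto
  also have "(\<integral>\<^sup>+x. F (x / t) \<partial>lborel) = ennreal t * (\<integral>\<^sup>+x. F x \<partial>lborel)"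
    using t by (subst nn_integral_real_affine[of _ t 0]) auto
  also have "\<dots> * ennreal (1 / t) = ennreal (t * (1 / t)) * (\<integral>\<^sup>+x. F x \<partial>lborel)"
    using t by (subst ennreal_mult) (simp_all add: mult_ac)
  finally show ?thesis using t by simp
qed

text \<open>
  This is Minkowski's inequality in disguise. For nonnegative functions it is an identity: the
  dilates \<open>x \<mapsto> F (x / t) / t\<close> all have the same integral, so an average of them with weight \<open>k\<close> has
  total mass \<open>\<integral> k\<close> times that of \<open>F\<close>.
\<close>
lemma nn_integral_dilation_average:
  fixes F k :: "real \<Rightarrow> ennreal"
  assumes [measurable]: "F \<in> borel_measurable borel" "k \<in> borel_measurable borel"
    and k: "\<And>t. t \<le> 0 \<Longrightarrow> k t = 0"
  shows "(\<integral>\<^sup>+x. \<integral>\<^sup>+t. F (x / t) * (k t * ennreal (1 / t)) \<partial>lborel \<partial>lborel) =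
    (\<integral>\<^sup>+t. k t \<partial>lborel) * (\<integral>\<^sup>+x. F x \<partial>lborel)"
proof -
  have "(\<integral>\<^sup>+x. \<integral>\<^sup>+t. F (x / t) * (k t * ennreal (1 / t)) \<partial>lborel \<partial>lborel) =
      (\<integral>\<^sup>+t. \<integral>\<^sup>+x. F (x / t) * (k t * ennreal (1 / t)) \<partial>lborel \<partial>lborel)"
    by (rule lborel_pair.Fubini') measurable
  also have "\<dots> = (\<integral>\<^sup>+t. k t * (\<integral>\<^sup>+x. F x \<partial>lborel) \<partial>lborel)"
  proof (intro nn_integral_cong)
    fix t :: real
    have "(\<integral>\<^sup>+x. F (x / t) * (k t * ennreal (1 / t)) \<partial>lborel) =
        k t * (\<integral>\<^sup>+x. F (x / t) * ennreal (1 / t) \<partial>lborel)"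
      by (subst nn_integral_cmult[symmetric]) (simp_all add: mult_ac)
    then show "(\<integral>\<^sup>+x. F (x / t) * (k t * ennreal (1 / t)) \<partial>lborel) = k t * (\<integral>\<^sup>+x. F x \<partial>lborel)"
      using k[of t] by (cases "t > 0") (simp_all add: nn_integral_dilate)
  qed
  also have "\<dots> = (\<integral>\<^sup>+t. k t \<partial>lborel) * (\<integral>\<^sup>+x. F x \<partial>lborel)"
    by (subst nn_integral_multc) auto
  finally show ?thesis .
qed

lemma dilation_integrand_norm:
  assumes "dilation_kernel \<phi>"
  shows "ennreal (cmod (z * (\<phi> t / of_real t))) = ennreal (cmod z) * (ennreal (cmod (\<phi> t)) * ennreal (1 / t))"
  using dilation_kernelD(3)[OF assms, of t]
  by (cases "t > 0") (simp_all add: norm_mult norm_divide flip: ennreal_mult)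

lemma hausdorff_integrand_finite:
  assumes f: "integrable lborel f" and \<phi>: "dilation_kernel \<phi>"
  shows "(\<integral>\<^sup>+x. \<integral>\<^sup>+t. ennreal (cmod (f (x / t) * (\<phi> t / of_real t))) \<partial>lborel \<partial>lborel) =
     (\<integral>\<^sup>+t. ennreal (cmod (\<phi> t)) \<partial>lborel) * (\<integral>\<^sup>+x. ennreal (cmod (f x)) \<partial>lborel)"
    and "(\<integral>\<^sup>+t. ennreal (cmod (\<phi> t)) \<partial>lborel) * (\<integral>\<^sup>+x. ennreal (cmod (f x)) \<partial>lborel) < \<infinity>"
proof -
  note [measurable] = dilation_kernelD(2)[OF \<phi>] borel_measurable_integrable[OF f, simplified]
  show "(\<integral>\<^sup>+x. \<integral>\<^sup>+t. ennreal (cmod (f (x / t) * (\<phi> t / of_real t))) \<partial>lborel \<partial>lborel) =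
     (\<integral>\<^sup>+t. ennreal (cmod (\<phi> t)) \<partial>lborel) * (\<integral>\<^sup>+x. ennreal (cmod (f x)) \<partial>lborel)"
    unfolding dilation_integrand_norm[OF \<phi>]
    by (rule nn_integral_dilation_average) (use dilation_kernelD(3)[OF \<phi>] in simp_all)
  show "(\<integral>\<^sup>+t. ennreal (cmod (\<phi> t)) \<partial>lborel) * (\<integral>\<^sup>+x. ennreal (cmod (f x)) \<partial>lborel) < \<infinity>"
    using f dilation_kernelD(4)[OF \<phi>] by (simp add: integrable_iff_bounded ennreal_mult_less_top)
qed

lemma borel_hausdorff_integrable:
  assumes f: "integrable lborel f" and \<phi>: "dilation_kernel \<phi>"
  shows "integrable lborel (borel_hausdorff \<phi> f)"
    and "AE x in lborel. integrable lborel (\<lambda>t. f (x / t) * (\<phi> t / of_real t))"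
proof -
  note [measurable] = dilation_kernelD(2)[OF \<phi>] borel_measurable_integrable[OF f, simplified]
  have m: "(\<lambda>(x, t). f (x / t) * (\<phi> t / of_real t)) \<in> borel_measurable (borel \<Otimes>\<^sub>M borel)"
    by measurable
  note * = lborel_integral_swap[OF m, unfolded hausdorff_integrand_finite(1)[OF f \<phi>],
    OF hausdorff_integrand_finite(2)[OF f \<phi>]]
  show "integrable lborel (borel_hausdorff \<phi> f)"
    using *(2) by (simp add: borel_hausdorff_def[abs_def])
  show "AE x in lborel. integrable lborel (\<lambda>t. f (x / t) * (\<phi> t / of_real t))"
    using *(4) .
qed

lemma borel_hausdorff_add:
  assumes \<phi>: "dilation_kernel \<phi>"
    and f: "integrable lborel f" and g: "integrable lborel g"
  shows "AE x in lborel. borel_hausdorff \<phi> (\<lambda>y. f y + g y) x = borel_hausdorff \<phi> f x + borel_hausdorff \<phi> g x"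
  using borel_hausdorff_integrable(2)[OF f \<phi>] borel_hausdorff_integrable(2)[OF g \<phi>]
  unfolding borel_hausdorff_def distrib_right
  by eventually_elim (rule Bochner_Integration.integral_add)

text \<open>
  If \<open>f = g\<close> off a null set \<open>N\<close>, then for each \<open>t > 0\<close> the set of \<open>x\<close> with \<open>x / t \<in> N\<close> is null. Exchanging
  the order of the two quantifiers by Fubini, for almost every \<open>x\<close> the integrands of the two operators
  agree for almost every \<open>t\<close>.
\<close>
lemma hausdorff_op_eq_borel_hausdorff:
  assumes f: "integrable lborel g" "AE x in lborel. f x = g x"
    and \<phi>: "dilation_kernel \<psi>" "AE t in lborel. indicator {0<..} t *\<^sub>R \<phi> t = \<psi> t"
  shows "AE x in lborel. hausdorff_op \<phi> f x = borel_hausdorff \<psi> g x"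
proof -
  note [measurable] = dilation_kernelD(2)[OF \<phi>(1)] borel_measurable_integrable[OF f(1), simplified]
  obtain N where N: "{x\<in>space lborel. f x \<noteq> g x} \<subseteq> N" "emeasure lborel N = 0"
    and Nm[measurable]: "N \<in> sets lborel"
    using f(2) by (rule AE_E)
  have "AE t in lborel. AE x in lborel. t > 0 \<longrightarrow> x / t \<notin> N"
  proof (rule AE_I2)
    fix t :: real
    have "AE x in lborel. x \<notin> N"
      using N Nm by (intro AE_not_in null_setsI) simp_all
    then have "AE x in lborel. 0 + (1 / t) * x \<notin> N" if "t > 0"
      using that by (intro AE_borel_affine) auto
    then show "AE x in lborel. t > 0 \<longrightarrow> x / t \<notin> N"
      by (cases "t > 0") auto
  qed
  also have "?this \<longleftrightarrow> (AE x in lborel. AE t in lborel. t > 0 \<longrightarrow> x / t \<notin> N)"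
    by (rule lborel_pair.AE_commute) measurable
  finally have 1: "AE x in lborel. AE t in lborel. indicator {0<..} t *\<^sub>R (f (x / t) * (\<phi> t / of_real t)) =
      g (x / t) * (\<psi> t / of_real t)"
  proof eventually_elim
    case (elim x)
    then show ?case using \<phi>(2)
    proof eventually_elim
      case (elim t)
      show ?case
      proof (cases "t > 0")
        case True
        then have "f (x / t) = g (x / t)" using elim N by auto
        then show ?thesis using True elim by simp
      qed (use dilation_kernelD(3)[OF \<phi>(1), of t] in simp)
    qed
  qed
  show "AE x in lborel. hausdorff_op \<phi> f x = borel_hausdorff \<psi> g x"
    using 1
  proof eventually_elim
    case (elim x)
    have "(\<lambda>t. g (x / t) * (\<psi> t / of_real t)) \<in> borel_measurable borel" by measurable
    then show ?case
      unfolding hausdorff_op_def borel_hausdorff_def set_lebesgue_integral_def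
      using elim by (rule lebesgue_integral_AE_borel)
  qed
qed

section \<open>Schwartz functions as averaging profiles\<close>

lemma schwartz_estimates:
  assumes "schwartz \<Phi>"
  obtains D C where "\<And>x. (\<Phi> has_vector_derivative D x) (at x)"
    "C \<ge> 0" "\<And>x. cmod (\<Phi> x) \<le> C" "\<And>x. x\<^sup>2 * cmod (\<Phi> x) \<le> C" "\<And>x. x\<^sup>2 * cmod (D x) \<le> C"
proof -
  obtain D where D: "D 0 = \<Phi>" "\<And>n x. (D n has_vector_derivative D (Suc n) x) (at x)"
    and bd: "\<And>k n. \<exists>C. \<forall>x. \<bar>x\<bar> ^ k * cmod (D n x) \<le> C"
    using assms unfolding schwartz_def by blast
  obtain A where A: "\<And>x. cmod (\<Phi> x) \<le> A" using bd[of 0 0] D(1) by auto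
  obtain B where B: "\<And>x. x\<^sup>2 * cmod (\<Phi> x) \<le> B" using bd[of 2 0] D(1) by auto
  obtain E where E: "\<And>x. x\<^sup>2 * cmod (D 1 x) \<le> E" using bd[of 2 1] by auto
  have "(\<Phi> has_vector_derivative D 1 x) (at x)" for x using D(2)[of 0 x] D(1) by simp
  then show thesis
    by (rule that[of "D 1" "max 0 (max A (max B E))"]) (simp, (meson A B E le_max_iff_disj)+)
qed

text \<open>
  Continuity makes the convolutions continuous, boundedness makes them converge for every integrable
  \<open>f\<close>, and integrability makes them converge for bounded \<open>f\<close>. All three properties pass to dilates.
\<close>
definition averaging_profile :: "(real \<Rightarrow> complex) \<Rightarrow> bool" where
  "averaging_profile \<Phi> \<longleftrightarrow> continuous_on UNIV \<Phi> \<and> bounded (range \<Phi>) \<and> integrable lborel \<Phi>"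

lemma schwartz_imp_averaging_profile:
  assumes "schwartz \<Phi>"
  shows "averaging_profile \<Phi>"
proof -
  obtain D C where D: "\<And>x. (\<Phi> has_vector_derivative D x) (at x)"
    and C: "C \<ge> 0" "\<And>x. cmod (\<Phi> x) \<le> C" "\<And>x. x\<^sup>2 * cmod (\<Phi> x) \<le> C"
    using schwartz_estimates[OF assms] by metis
  have cont: "continuous_on UNIV \<Phi>"
    using D by (meson continuous_at_imp_continuous_on has_vector_derivative_continuous)
  then have [measurable]: "\<Phi> \<in> borel_measurable borel"
    by (rule borel_measurable_continuous_onI)
  have bound: "cmod (\<Phi> x) \<le> 2 * C * inverse (1 + x\<^sup>2)" for x
    using C(2,3)[of x] by (simp add: field_simps add_pos_nonneg)
  have "integrable lborel (\<lambda>x::real. 2 * C * inverse (1 + x\<^sup>2))"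
    using integrable_inverse_1_plus_square by (simp add: set_integrable_def)
  then have "integrable lborel \<Phi>"
    by (rule Bochner_Integration.integrable_bound)
      (use bound C(1) in \<open>auto intro!: AE_I2 simp: abs_mult\<close>)
  then show ?thesis
    using cont C(2) unfolding averaging_profile_def bounded_iff by blast
qed

lemma averaging_profileD:
  assumes "averaging_profile \<Phi>"
  shows "continuous_on UNIV \<Phi>" "\<Phi> \<in> borel_measurable borel" "integrable lborel \<Phi>"
  using assms by (auto simp: averaging_profile_def intro: borel_measurable_continuous_onI)

lemma averaging_profile_dilate:
  assumes \<Phi>: "averaging_profile \<Phi>" and r: "r > 0"
  shows "averaging_profile (dilate r \<Phi>)"
proof -
  obtain C where C: "\<And>x. cmod (\<Phi> x) \<le> C"
    using \<Phi> unfolding averaging_profile_def bounded_iff by blast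
  have "continuous_on UNIV (\<lambda>x. \<Phi> (x / r))"
    using r by (intro continuous_on_compose2[OF averaging_profileD(1)[OF \<Phi>]] continuous_intros) auto
  then have "continuous_on UNIV (dilate r \<Phi>)"
    unfolding dilate_def[abs_def] using r by (intro continuous_intros) auto
  moreover have "bounded (range (dilate r \<Phi>))"
    unfolding bounded_iff dilate_def
    using C r by (auto intro!: exI[of _ "C / r"] simp: norm_divide divide_right_mono)
  moreover have "integrable lborel (dilate r \<Phi>)"
    using lborel_integrable_real_affine[OF averaging_profileD(3)[OF \<Phi>], of "1 / r" 0] r
    by (simp add: dilate_def[abs_def])
  ultimately show ?thesis by (simp add: averaging_profile_def)
qed

section \<open>The maximal function and the Hardy norm\<close>

lemma convolve_eq_lborel:
  assumes [measurable]: "f \<in> borel_measurable borel" "g \<in> borel_measurable borel"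
  shows "convolve f g x = (LINT y|lborel. f (x - y) * g y)"
    and "convolve f g x = (LINT y|lborel. f y * g (x - y))"
proof -
  show 1: "convolve f g x = (LINT y|lborel. f (x - y) * g y)"
    unfolding convolve_def by (rule integral_completion) simp
  show "convolve f g x = (LINT y|lborel. f y * g (x - y))"
    unfolding 1 by (subst lborel_integral_real_affine[of "-1" _ x]) simp_all
qed

lemma convolve_cong_AE:
  assumes [measurable]: "f' \<in> borel_measurable borel" "g \<in> borel_measurable borel"
    and ae: "AE x in lborel. f x = f' x"
  shows "convolve f g x = convolve f' g x"
proof -
  obtain N where N: "{x\<in>space lborel. f x \<noteq> f' x} \<subseteq> N" "emeasure lborel N = 0"
    and Nm[measurable]: "N \<in> sets lborel"
    using ae by (rule AE_E)
  have "AE y in lborel. y \<notin> N"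
    using N Nm by (intro AE_not_in null_setsI) simp_all
  then have "AE y in lborel. x + (-1) * y \<notin> N"
    by (intro AE_borel_affine) auto
  then have "AE y in lborel. f (x - y) * g y = f' (x - y) * g y"
    by eventually_elim (use N(1) in auto)
  then show ?thesis
    unfolding convolve_eq_lborel(1)[OF assms(1,2)] unfolding convolve_def
    by (intro lebesgue_integral_AE_borel(1)) auto
qed

lemma convolution_integrable:
  assumes f: "integrable lborel f" and g: "averaging_profile g"
  shows "integrable lborel (\<lambda>y. f y * g (x - y))"
proof -
  note [measurable] = averaging_profileD(2)[OF g] borel_measurable_integrable[OF f, simplified]
  obtain C where C: "\<And>x. cmod (g x) \<le> C"
    using g unfolding averaging_profile_def bounded_iff by blast
  have "C \<ge> 0" using C[of 0] norm_ge_zero order_trans by blast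
  show ?thesis
  proof (rule Bochner_Integration.integrable_bound)
    show "integrable lborel (\<lambda>y. of_real C * f y)" using f by simp
    show "AE y in lborel. cmod (f y * g (x - y)) \<le> cmod (of_real C * f y)"
      using C \<open>C \<ge> 0\<close> by (auto intro!: AE_I2 simp: norm_mult mult.commute[of C] mult_left_mono)
  qed simp
qed

lemma continuous_convolve:
  assumes f: "integrable lborel f" and g: "averaging_profile g"
  shows "continuous_on UNIV (convolve f g)"
proof -
  note [measurable] = averaging_profileD(2)[OF g] borel_measurable_integrable[OF f, simplified]
  obtain C where C: "\<And>x. cmod (g x) \<le> C"
    using g unfolding averaging_profile_def bounded_iff by blast
  have gc: "isCont g z" for z
    using averaging_profileD(1)[OF g] by (simp add: continuous_on_eq_continuous_at)
  have "isCont (convolve f g) x" for x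
    unfolding continuous_at_sequentially comp_def
  proof safe
    fix X :: "nat \<Rightarrow> real" assume X: "X \<longlonglongrightarrow> x"
    have "(\<lambda>n. LINT y|lborel. f y * g (X n - y)) \<longlonglongrightarrow> (LINT y|lborel. f y * g (x - y))"
    proof (rule integral_dominated_convergence[where w="\<lambda>y. C * cmod (f y)"])
      show "AE y in lborel. (\<lambda>n. f y * g (X n - y)) \<longlonglongrightarrow> f y * g (x - y)"
        by (intro AE_I2 tendsto_intros isCont_tendsto_compose[OF gc] X)
      show "AE y in lborel. cmod (f y * g (X n - y)) \<le> C * cmod (f y)" for n
        using C by (auto intro!: AE_I2 simp: norm_mult mult.commute[of C] mult_left_mono)
    qed (use f in auto)
    then show "(\<lambda>n. convolve f g (X n)) \<longlonglongrightarrow> convolve f g x"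
      by (simp add: convolve_eq_lborel(2))
  qed
  then show ?thesis by (simp add: continuous_on_eq_continuous_at)
qed

text \<open>
  The supremum is over an uncountable set of scales, but each \<open>f * \<Phi>\<^sub>t\<close> is continuous, so the maximal
  function is lower semicontinuous.
\<close>
lemma borel_measurable_smooth_maximal:
  assumes f: "integrable lborel f" and \<Phi>: "averaging_profile \<Phi>"
  shows "smooth_maximal \<Phi> f \<in> borel_measurable borel"
proof (rule borel_measurableI_greater)
  fix a :: ennreal
  have "open {x. a < ennreal (cmod (convolve f (dilate t \<Phi>) x))}" if "t > 0" for t
    using continuous_convolve[OF f averaging_profile_dilate[OF \<Phi> that]]
    by (intro open_Collect_less continuous_intros continuous_on_ennreal)
  then have "open (\<Union>t\<in>{0<..}. {x. a < ennreal (cmod (convolve f (dilate t \<Phi>) x))})"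
    by (intro open_UN) auto
  also have "(\<Union>t\<in>{0<..}. {x. a < ennreal (cmod (convolve f (dilate t \<Phi>) x))}) =
      {x \<in> space borel. a < smooth_maximal \<Phi> f x}"
    by (auto simp: smooth_maximal_def less_SUP_iff)
  finally show "{x \<in> space borel. a < smooth_maximal \<Phi> f x} \<in> sets borel"
    by simp
qed

lemma H1_norm_cong_AE:
  assumes "f' \<in> borel_measurable borel" "averaging_profile \<Phi>" "AE x in lborel. f x = f' x"
  shows "H1_norm \<Phi> f = H1_norm \<Phi> f'"
proof -
  have "smooth_maximal \<Phi> f x = smooth_maximal \<Phi> f' x" for x
    unfolding smooth_maximal_def
    by (intro SUP_cong refl)
      (simp add: convolve_cong_AE[OF assms(1) averaging_profileD(2)[OF averaging_profile_dilate[OF assms(2)]] assms(3)])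
  then show ?thesis by (simp add: H1_norm_def)
qed

lemma H1_norm_lborel: "H1_norm \<Phi> f = (\<integral>\<^sup>+x. smooth_maximal \<Phi> f x \<partial>lborel)"
  by (simp add: H1_norm_def nn_integral_completion)

lemma H1_norm_cmult:
  assumes f: "integrable lborel f" and \<Phi>: "averaging_profile \<Phi>"
  shows "H1_norm \<Phi> (\<lambda>x. c * f x) = ennreal (cmod c) * H1_norm \<Phi> f"
proof -
  have "smooth_maximal \<Phi> (\<lambda>x. c * f x) x = ennreal (cmod c) * smooth_maximal \<Phi> f x" for x
    by (simp add: smooth_maximal_def convolve_def SUP_mult_left_ennreal norm_mult ennreal_mult mult.assoc)
  then show ?thesis
    using borel_measurable_smooth_maximal[OF f \<Phi>]
    by (simp add: H1_norm_lborel nn_integral_cmult)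
qed

lemma H1_norm_triangle:
  assumes f: "integrable lborel f" and g: "integrable lborel g" and \<Phi>: "averaging_profile \<Phi>"
  shows "H1_norm \<Phi> (\<lambda>x. f x + g x) \<le> H1_norm \<Phi> f + H1_norm \<Phi> g"
proof -
  note [measurable] = borel_measurable_integrable[OF f, simplified] borel_measurable_integrable[OF g, simplified]
    borel_measurable_smooth_maximal[OF f \<Phi>] borel_measurable_smooth_maximal[OF g \<Phi>]
  have "smooth_maximal \<Phi> (\<lambda>x. f x + g x) x \<le> smooth_maximal \<Phi> f x + smooth_maximal \<Phi> g x" for x
    unfolding smooth_maximal_def
  proof (rule SUP_least)
    fix t :: real assume t: "t \<in> {0<..}"
    then have \<Phi>t: "averaging_profile (dilate t \<Phi>)" using \<Phi> by (simp add: averaging_profile_dilate)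
    note [measurable] = averaging_profileD(2)[OF \<Phi>t]
    have "convolve (\<lambda>x. f x + g x) (dilate t \<Phi>) x = convolve f (dilate t \<Phi>) x + convolve g (dilate t \<Phi>) x"
      using convolution_integrable[OF f \<Phi>t] convolution_integrable[OF g \<Phi>t]
      by (simp add: convolve_eq_lborel(2) distrib_right)
    then have "ennreal (cmod (convolve (\<lambda>x. f x + g x) (dilate t \<Phi>) x)) \<le>
        ennreal (cmod (convolve f (dilate t \<Phi>) x)) + ennreal (cmod (convolve g (dilate t \<Phi>) x))"
      by (simp add: norm_triangle_ineq flip: ennreal_plus)
    also have "\<dots> \<le> (SUP t\<in>{0<..}. ennreal (cmod (convolve f (dilate t \<Phi>) x))) +
        (SUP t\<in>{0<..}. ennreal (cmod (convolve g (dilate t \<Phi>) x)))"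
      using t by (intro add_mono SUP_upper)
    finally show "ennreal (cmod (convolve (\<lambda>x. f x + g x) (dilate t \<Phi>) x)) \<le> \<dots>" .
  qed
  then show ?thesis
    unfolding H1_norm_lborel by (subst nn_integral_add[symmetric]) (auto intro!: nn_integral_mono)
qed

section \<open>The upper bound\<close>

text \<open>
  Dilating by \<open>t\<close> and then smoothing at scale \<open>r\<close> is the same as smoothing at scale \<open>r / t\<close> and then
  dilating by \<open>t\<close>.
\<close>
lemma convolve_borel_hausdorff:
  assumes f: "integrable lborel f" and \<Phi>: "averaging_profile \<Phi>" and \<phi>: "dilation_kernel \<phi>"
    and r: "r > 0"
  shows "convolve (borel_hausdorff \<phi> f) (dilate r \<Phi>) x =
    (LINT t|lborel. convolve f (dilate (r / t) \<Phi>) (x / t) * (\<phi> t / of_real t))"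
proof -
  note \<Phi>r = averaging_profile_dilate[OF \<Phi> r]
  note [measurable] = averaging_profileD(2)[OF \<Phi>] averaging_profileD(2)[OF \<Phi>r]
    borel_measurable_integrable[OF f, simplified] dilation_kernelD(2)[OF \<phi>]
    borel_measurable_integrable[OF borel_hausdorff_integrable(1)[OF f \<phi>], simplified]
  obtain C where C: "\<And>x. cmod (dilate r \<Phi> x) \<le> C"
    using \<Phi>r unfolding averaging_profile_def bounded_iff by blast
  have m: "(\<lambda>(y, t). f (y / t) * (\<phi> t / of_real t) * dilate r \<Phi> (x - y)) \<in> borel_measurable (borel \<Otimes>\<^sub>M borel)"
    by measurable
  have "(\<integral>\<^sup>+y. \<integral>\<^sup>+t. ennreal (cmod (f (y / t) * (\<phi> t / of_real t) * dilate r \<Phi> (x - y))) \<partial>lborel \<partial>lborel)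
      \<le> (\<integral>\<^sup>+y. \<integral>\<^sup>+t. ennreal C * ennreal (cmod (f (y / t) * (\<phi> t / of_real t))) \<partial>lborel \<partial>lborel)"
  proof (intro nn_integral_mono)
    fix y t :: real
    have "ennreal (cmod (a * b)) \<le> ennreal C * ennreal (cmod a)" if "cmod b \<le> C" for a b :: complex
      using that order_trans[OF norm_ge_zero that]
      by (simp add: norm_mult mult.commute[of C] mult_left_mono flip: ennreal_mult)
    then show "ennreal (cmod (f (y / t) * (\<phi> t / of_real t) * dilate r \<Phi> (x - y))) \<le>
        ennreal C * ennreal (cmod (f (y / t) * (\<phi> t / of_real t)))"
      using C by blast
  qed
  also have "\<dots> = ennreal C * (\<integral>\<^sup>+y. \<integral>\<^sup>+t. ennreal (cmod (f (y / t) * (\<phi> t / of_real t))) \<partial>lborel \<partial>lborel)"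
    by (simp add: nn_integral_cmult)
  also have "\<dots> < \<infinity>"
    using hausdorff_integrand_finite[OF f \<phi>] by (simp add: ennreal_mult_less_top)
  finally have fin: "(\<integral>\<^sup>+y. \<integral>\<^sup>+t. ennreal (cmod (f (y / t) * (\<phi> t / of_real t) * dilate r \<Phi> (x - y))) \<partial>lborel \<partial>lborel) < \<infinity>" .
  have "convolve (borel_hausdorff \<phi> f) (dilate r \<Phi>) x =
      (LINT y|lborel. LINT t|lborel. f (y / t) * (\<phi> t / of_real t) * dilate r \<Phi> (x - y))"
    by (subst convolve_eq_lborel(2)) (simp_all add: borel_hausdorff_def del: times_divide_eq_right)
  also have "\<dots> = (LINT t|lborel. LINT y|lborel. f (y / t) * (\<phi> t / of_real t) * dilate r \<Phi> (x - y))"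
    by (rule lborel_integral_swap(1)[OF m fin])
  also have "\<dots> = (LINT t|lborel. convolve f (dilate (r / t) \<Phi>) (x / t) * (\<phi> t / of_real t))"
  proof (intro Bochner_Integration.integral_cong refl)
    fix t :: real
    show "(LINT y|lborel. f (y / t) * (\<phi> t / of_real t) * dilate r \<Phi> (x - y)) =
        convolve f (dilate (r / t) \<Phi>) (x / t) * (\<phi> t / of_real t)"
    proof (cases "t > 0")
      case True
      have "(LINT y|lborel. f (y / t) * (\<phi> t / of_real t) * dilate r \<Phi> (x - y)) =
          t *\<^sub>R (LINT u|lborel. f u * (\<phi> t / of_real t) * dilate r \<Phi> (x - t * u))"
        using True by (subst lborel_integral_real_affine[of t _ 0]) simp_all
      also have "\<dots> = t *\<^sub>R (LINT u|lborel. (\<phi> t / of_real t / of_real t) * (f u * dilate (r / t) \<Phi> (x / t - u)))"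
      proof -
        have "dilate r \<Phi> (x - t * u) = dilate (r / t) \<Phi> (x / t - u) / of_real t" for u
        proof -
          have "(x / t - u) / (r / t) = (x - t * u) / r"
            using True r by (simp add: field_simps)
          then show ?thesis using True r by (simp add: dilate_def)
        qed
        then show ?thesis by (simp add: mult_ac)
      qed
      also have "\<dots> = convolve f (dilate (r / t) \<Phi>) (x / t) * (\<phi> t / of_real t)"
        using True r averaging_profileD(2)[OF averaging_profile_dilate[OF \<Phi>, of "r / t"]]
        by (subst convolve_eq_lborel(2)) (simp_all add: scaleR_conv_of_real)
      finally show ?thesis .
    qed (use dilation_kernelD(3)[OF \<phi>, of t] in simp)
  qed
  finally show ?thesis .
qed

lemma norm_integral_le_nn_integral:
  fixes f :: "'a \<Rightarrow> complex"
  shows "ennreal (cmod (integral\<^sup>L M f)) \<le> (\<integral>\<^sup>+x. ennreal (cmod (f x)) \<partial>M)"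
  by (cases "integrable M f") (simp_all add: integral_norm_bound_ennreal not_integrable_integral_eq)

lemma smooth_maximal_borel_hausdorff_le:
  assumes f: "integrable lborel f" and \<Phi>: "averaging_profile \<Phi>" and \<phi>: "dilation_kernel \<phi>"
  shows "smooth_maximal \<Phi> (borel_hausdorff \<phi> f) x \<le>
    (\<integral>\<^sup>+t. smooth_maximal \<Phi> f (x / t) * (ennreal (cmod (\<phi> t)) * ennreal (1 / t)) \<partial>lborel)"
  unfolding smooth_maximal_def[of \<Phi> "borel_hausdorff \<phi> f"]
proof (rule SUP_least)
  fix r :: real assume "r \<in> {0<..}"
  then have r: "r > 0" by simp
  have "ennreal (cmod (convolve (borel_hausdorff \<phi> f) (dilate r \<Phi>) x)) \<le>
      (\<integral>\<^sup>+t. ennreal (cmod (convolve f (dilate (r / t) \<Phi>) (x / t) * (\<phi> t / of_real t))) \<partial>lborel)"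
    unfolding convolve_borel_hausdorff[OF f \<Phi> \<phi> r] by (rule norm_integral_le_nn_integral)
  also have "\<dots> \<le> (\<integral>\<^sup>+t. smooth_maximal \<Phi> f (x / t) * (ennreal (cmod (\<phi> t)) * ennreal (1 / t)) \<partial>lborel)"
  proof (intro nn_integral_mono)
    fix t :: real
    show "ennreal (cmod (convolve f (dilate (r / t) \<Phi>) (x / t) * (\<phi> t / of_real t))) \<le>
        smooth_maximal \<Phi> f (x / t) * (ennreal (cmod (\<phi> t)) * ennreal (1 / t))"
    proof (cases "t > 0")
      case True
      then have "ennreal (cmod (convolve f (dilate (r / t) \<Phi>) (x / t))) \<le> smooth_maximal \<Phi> f (x / t)"
        unfolding smooth_maximal_def using r by (intro SUP_upper) simp
      then show ?thesis
        unfolding dilation_integrand_norm[OF \<phi>] by (rule mult_right_mono) simp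
    qed (use dilation_kernelD(3)[OF \<phi>, of t] in simp)
  qed
  finally show "ennreal (cmod (convolve (borel_hausdorff \<phi> f) (dilate r \<Phi>) x)) \<le> \<dots>" .
qed

lemma H1_norm_borel_hausdorff_le:
  assumes f: "integrable lborel f" and \<Phi>: "averaging_profile \<Phi>" and \<phi>: "dilation_kernel \<phi>"
  shows "H1_norm \<Phi> (borel_hausdorff \<phi> f) \<le> (\<integral>\<^sup>+t. ennreal (cmod (\<phi> t)) \<partial>lborel) * H1_norm \<Phi> f"
proof -
  have "H1_norm \<Phi> (borel_hausdorff \<phi> f) \<le>
      (\<integral>\<^sup>+x. \<integral>\<^sup>+t. smooth_maximal \<Phi> f (x / t) * (ennreal (cmod (\<phi> t)) * ennreal (1 / t)) \<partial>lborel \<partial>lborel)"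
    unfolding H1_norm_lborel by (intro nn_integral_mono smooth_maximal_borel_hausdorff_le f \<Phi> \<phi>)
  also have "\<dots> = (\<integral>\<^sup>+t. ennreal (cmod (\<phi> t)) \<partial>lborel) * H1_norm \<Phi> f"
    unfolding H1_norm_lborel
    using borel_measurable_smooth_maximal[OF f \<Phi>] dilation_kernelD(2,3)[OF \<phi>]
    by (intro nn_integral_dilation_average) simp_all
  finally show ?thesis .
qed

section \<open>Composition of Hausdorff operators\<close>

lemma dilation_kernel_borel_hausdorff:
  assumes \<phi>: "dilation_kernel \<phi>" and \<psi>: "dilation_kernel \<psi>"
  shows "dilation_kernel (borel_hausdorff \<phi> \<psi>)"
  unfolding dilation_kernel_def
proof (intro conjI allI impI)
  show "integrable lborel (borel_hausdorff \<phi> \<psi>)"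
    by (rule borel_hausdorff_integrable(1)[OF dilation_kernelD(1)[OF \<psi>] \<phi>])
  fix u :: real assume "u \<le> 0"
  then have support: "\<psi> (u / t) * (\<phi> t / of_real t) = 0" for t
    using dilation_kernelD(3)[OF \<phi>, of t] dilation_kernelD(3)[OF \<psi>, of "u / t"]
    by (cases "t > 0") (auto simp: divide_nonpos_pos)
  show "borel_hausdorff \<phi> \<psi> u = 0" unfolding borel_hausdorff_def support by simp
qed

text \<open>
  \<open>borel_hausdorff \<phi> \<psi>\<close> is the convolution of \<open>\<phi>\<close> and \<open>\<psi>\<close> on the multiplicative group \<open>(0,\<infinity>)\<close>, and
  dilations satisfy \<open>D\<^sub>t D\<^sub>s = D\<^bsub>ts\<^esub>\<close>. The substitution \<open>u = t s\<close> in the inner integral and Fubini give the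
  formula at every \<open>x\<close> where the double integral converges absolutely. By Tonelli the integral over \<open>x\<close>
  of the double integral of absolute values is \<open>\<parallel>\<phi>\<parallel>\<^sub>1 \<parallel>\<psi>\<parallel>\<^sub>1 \<parallel>f\<parallel>\<^sub>1\<close>, so almost every \<open>x\<close> qualifies.
\<close>
lemma borel_hausdorff_compose:
  assumes f: "integrable lborel f" and \<phi>: "dilation_kernel \<phi>" and \<psi>: "dilation_kernel \<psi>"
  shows "AE x in lborel. borel_hausdorff \<phi> (borel_hausdorff \<psi> f) x =
    borel_hausdorff (borel_hausdorff \<phi> \<psi>) f x"
proof -
  note [measurable] = dilation_kernelD(2)[OF \<phi>] dilation_kernelD(2)[OF \<psi>]
    borel_measurable_integrable[OF f, simplified]
  define K where "K x t u = f (x / u) * (\<psi> (u / t) * (\<phi> t / of_real t) / of_real u)" for x t u :: real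
  \<comment> \<open>\<open>g\<close> is the multiplicative convolution of \<open>|\<phi>|\<close> and \<open>|\<psi>|\<close>.\<close>
  define g where "g u = (\<integral>\<^sup>+t. ennreal (cmod (\<psi> (u / t) * (\<phi> t / of_real t))) \<partial>lborel)" for u :: real
  have Km[measurable]: "case_prod (K x) \<in> borel_measurable (borel \<Otimes>\<^sub>M borel)" for x
    unfolding K_def by measurable
  have gm[measurable]: "g \<in> borel_measurable borel"
    unfolding g_def by measurable
  have support: "\<psi> (u / t) * (\<phi> t / of_real t) = 0" if "u \<le> 0" for u t
    using that dilation_kernelD(3)[OF \<phi>, of t] dilation_kernelD(3)[OF \<psi>, of "u / t"]
    by (cases "t > 0") (auto simp: divide_nonpos_pos)
  have g0: "g u = 0" if "u \<le> 0" for u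
    unfolding g_def support[OF that] by simp
  have norm_K: "ennreal (cmod (K x t u)) =
      ennreal (cmod (f (x / u))) * ennreal (1 / u) * ennreal (cmod (\<psi> (u / t) * (\<phi> t / of_real t)))" for x t u
    using support[of u t]
    by (cases "u > 0") (auto simp: K_def norm_mult norm_divide mult_ac simp flip: ennreal_mult)
  have norm_K': "(\<integral>\<^sup>+t. \<integral>\<^sup>+u. ennreal (cmod (K x t u)) \<partial>lborel \<partial>lborel) =
      (\<integral>\<^sup>+u. ennreal (cmod (f (x / u))) * (g u * ennreal (1 / u)) \<partial>lborel)" for x
  proof -
    have "(\<integral>\<^sup>+t. \<integral>\<^sup>+u. ennreal (cmod (K x t u)) \<partial>lborel \<partial>lborel) =
        (\<integral>\<^sup>+u. \<integral>\<^sup>+t. ennreal (cmod (K x t u)) \<partial>lborel \<partial>lborel)"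
      by (rule lborel_pair.Fubini'[symmetric]) measurable
    also have "\<dots> = (\<integral>\<^sup>+u. ennreal (cmod (f (x / u))) * (g u * ennreal (1 / u)) \<partial>lborel)"
      unfolding norm_K g_def
      by (intro nn_integral_cong, subst nn_integral_cmult) (simp_all add: mult_ac)
    finally show ?thesis .
  qed
  have "(\<integral>\<^sup>+x. \<integral>\<^sup>+u. ennreal (cmod (f (x / u))) * (g u * ennreal (1 / u)) \<partial>lborel \<partial>lborel) =
      (\<integral>\<^sup>+u. g u \<partial>lborel) * (\<integral>\<^sup>+x. ennreal (cmod (f x)) \<partial>lborel)"
    by (rule nn_integral_dilation_average) (simp_all add: g0)
  also have "\<dots> < \<infinity>"
    using hausdorff_integrand_finite[OF dilation_kernelD(1)[OF \<psi>] \<phi>] f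
    by (simp add: g_def ennreal_mult_less_top integrable_iff_bounded)
  finally have "AE x in lborel. (\<integral>\<^sup>+u. ennreal (cmod (f (x / u))) * (g u * ennreal (1 / u)) \<partial>lborel) \<noteq> \<infinity>"
    by (intro nn_integral_noteq_infinite) auto
  then show ?thesis
  proof eventually_elim
    case (elim x)
    then have fin: "(\<integral>\<^sup>+t. \<integral>\<^sup>+u. ennreal (cmod (K x t u)) \<partial>lborel \<partial>lborel) < \<infinity>"
      unfolding norm_K' by (simp add: less_top)
    have "borel_hausdorff \<phi> (borel_hausdorff \<psi> f) x = (LINT t|lborel. LINT u|lborel. K x t u)"
      unfolding borel_hausdorff_def[of \<phi>]
    proof (intro Bochner_Integration.integral_cong refl)
      fix t :: real
      show "borel_hausdorff \<psi> f (x / t) * (\<phi> t / of_real t) = (LINT u|lborel. K x t u)"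
      proof (cases "t > 0")
        case True
        have "(LINT u|lborel. K x t u) = t *\<^sub>R (LINT s|lborel. K x t (t * s))"
          using True by (subst lborel_integral_real_affine[of t _ 0]) simp_all
        also have "(LINT s|lborel. K x t (t * s)) =
            (LINT s|lborel. f (x / t / s) * (\<psi> s / of_real s) * (\<phi> t / of_real t / of_real t))"
          using True by (intro Bochner_Integration.integral_cong refl) (simp add: K_def mult_ac)
        also have "\<dots> = borel_hausdorff \<psi> f (x / t) * (\<phi> t / of_real t / of_real t)"
          unfolding borel_hausdorff_def by (rule integral_mult_left_zero)
        also have "t *\<^sub>R \<dots> = borel_hausdorff \<psi> f (x / t) * (\<phi> t / of_real t)"
          using True by (simp add: scaleR_conv_of_real)
        finally show ?thesis ..
      qed (use dilation_kernelD(3)[OF \<phi>, of t] in \<open>simp add: K_def\<close>)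
    qed
    also have "\<dots> = (LINT u|lborel. LINT t|lborel. K x t u)"
      by (rule lborel_integral_swap(1)[OF Km fin])
    also have "\<dots> = borel_hausdorff (borel_hausdorff \<phi> \<psi>) f x"
      by (simp add: K_def borel_hausdorff_def del: times_divide_eq_right)
    finally show ?case .
  qed
qed

text \<open>
  Kernels \<open>\<psi>\<close> that \<open>\<phi>\<close> nearly reproduces up to the factor \<open>c\<close> in \<open>L\<^sup>1\<close> thus yield functions
  \<open>borel_hausdorff \<psi> f\<close> that are approximate eigenfunctions of \<open>borel_hausdorff \<phi>\<close>, with an error that
  the \<open>L\<^sup>1\<close> bound for Hausdorff operators controls.
\<close>
lemma borel_hausdorff_defect:
  fixes c :: complex
  assumes f: "integrable lborel f" and \<phi>: "dilation_kernel \<phi>" and \<psi>: "dilation_kernel \<psi>"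
  defines "\<theta> \<equiv> (\<lambda>u. borel_hausdorff \<phi> \<psi> u - c * \<psi> u)"
  shows "dilation_kernel \<theta>"
    and "AE x in lborel. borel_hausdorff \<phi> (borel_hausdorff \<psi> f) x - c * borel_hausdorff \<psi> f x =
      borel_hausdorff \<theta> f x"
proof -
  note \<phi>\<psi> = dilation_kernel_borel_hausdorff[OF \<phi> \<psi>]
  show "dilation_kernel \<theta>"
    using \<phi>\<psi> \<psi> unfolding dilation_kernel_def \<theta>_def by auto
  show "AE x in lborel. borel_hausdorff \<phi> (borel_hausdorff \<psi> f) x - c * borel_hausdorff \<psi> f x =
      borel_hausdorff \<theta> f x"
    using borel_hausdorff_compose[OF f \<phi> \<psi>] borel_hausdorff_integrable(2)[OF f \<phi>\<psi>]
      borel_hausdorff_integrable(2)[OF f \<psi>]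
  proof eventually_elim
    case (elim x)
    have "borel_hausdorff \<theta> f x = (LINT t|lborel. f (x / t) * (borel_hausdorff \<phi> \<psi> t / of_real t) -
        c * (f (x / t) * (\<psi> t / of_real t)))"
      unfolding borel_hausdorff_def[of \<theta>] unfolding \<theta>_def
      by (intro Bochner_Integration.integral_cong refl) (simp add: diff_divide_distrib algebra_simps)
    also have "\<dots> = borel_hausdorff (borel_hausdorff \<phi> \<psi>) f x - c * borel_hausdorff \<psi> f x"
      using elim(2,3) unfolding borel_hausdorff_def[of _ f]
      by (subst Bochner_Integration.integral_diff) (simp_all del: times_divide_eq_right)
    finally show ?case using elim(1) by simp
  qed
qed

section \<open>An odd atom\<close>

text \<open>
  On the interval between \<open>u - h\<close> and \<open>u\<close> all points have absolute value at least \<open>|u| / 2\<close>, so the decay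
  \<open>|\<Phi>' z| \<le> K / z\<^sup>2\<close> and the mean value inequality give the bound with \<open>C = 4 K\<close>.
\<close>
lemma schwartz_increment:
  assumes "schwartz \<Phi>"
  obtains C where "C \<ge> 0" "\<And>u h. \<bar>h\<bar> \<le> \<bar>u\<bar> / 2 \<Longrightarrow> u\<^sup>2 * cmod (\<Phi> (u - h) - \<Phi> u) \<le> C * \<bar>h\<bar>"
proof -
  obtain D K where D: "\<And>x. (\<Phi> has_vector_derivative D x) (at x)"
    and K: "K \<ge> 0" "\<And>x. x\<^sup>2 * cmod (D x) \<le> K"
    using schwartz_estimates[OF assms] by metis
  have "u\<^sup>2 * cmod (\<Phi> (u - h) - \<Phi> u) \<le> 4 * K * \<bar>h\<bar>" if h: "\<bar>h\<bar> \<le> \<bar>u\<bar> / 2" for u h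
  proof (cases "u = 0")
    case False
    have "cmod (\<Phi> (u - h) - \<Phi> u) \<le> 4 * K / u\<^sup>2 * norm ((u - h) - u)"
    proof (rule differentiable_bound[where S="cball u \<bar>h\<bar>" and f'="\<lambda>x r. r *\<^sub>R D x"])
      fix x assume "x \<in> cball u \<bar>h\<bar>"
      then have "\<bar>u\<bar> / 2 \<le> \<bar>x\<bar>" using h by (auto simp: dist_real_def)
      then have "(\<bar>u\<bar> / 2)\<^sup>2 \<le> \<bar>x\<bar>\<^sup>2" by (intro power_mono) auto
      then have "u\<^sup>2 * cmod (D x) \<le> 4 * (x\<^sup>2 * cmod (D x))"
        using mult_right_mono[of "u\<^sup>2" "4 * x\<^sup>2" "cmod (D x)"] by (simp add: power_divide mult.assoc)
      then have "cmod (D x) \<le> 4 * K / u\<^sup>2"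
        using K(2)[of x] False by (simp add: field_simps)
      then show "onorm (\<lambda>r. r *\<^sub>R D x) \<le> 4 * K / u\<^sup>2"
        using K(1) mult_right_mono[OF _ abs_ge_zero, of "cmod (D x)" "4 * K / u\<^sup>2"]
        by (intro onorm_bound) (simp_all add: mult.commute)
      show "(\<Phi> has_derivative (\<lambda>r. r *\<^sub>R D x)) (at x within cball u \<bar>h\<bar>)"
        using D[of x] unfolding has_vector_derivative_def by (rule has_derivative_at_withinI)
    qed (auto simp: dist_real_def)
    then show ?thesis using False by (simp add: field_simps)
  qed (use h in simp)
  then show thesis using K(1) by (intro that[of "4 * K"]) auto
qed

definition odd_atom :: "real \<Rightarrow> complex" where
  "odd_atom x = of_real (sgn x * indicator {-1..1} x)"

lemma odd_atom_measurable[measurable]: "odd_atom \<in> borel_measurable borel"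
  unfolding odd_atom_def[abs_def] by measurable

lemma norm_odd_atom_le: "cmod (odd_atom x) \<le> indicator {-1..1} x"
  by (auto simp: odd_atom_def sgn_if split: split_indicator)

lemma odd_atom_integrable: "integrable lborel odd_atom"
  by (rule Bochner_Integration.integrable_bound[of _ "\<lambda>x::real. indicator {-1..1} x :: real"])
    (use norm_odd_atom_le in \<open>auto intro!: AE_I2\<close>)

lemma integral_odd_atom: "(LINT x|lborel. odd_atom x) = 0"
proof -
  have "(LINT x|lborel. odd_atom x) = (LINT x|lborel. odd_atom (- x))"
    by (subst lborel_integral_real_affine[of "-1" _ 0]) simp_all
  also have "\<dots> = - (LINT x|lborel. odd_atom x)"
    unfolding integral_minus[symmetric]
    by (intro Bochner_Integration.integral_cong refl) (auto simp: odd_atom_def sgn_minus split: split_indicator)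
  finally show ?thesis by (simp add: eq_neg_iff_add_eq_0)
qed

text \<open>
  Far from the support the vanishing integral of the atom permits subtracting \<open>\<Phi>\<^sub>r x\<close> from the
  convolution kernel \<open>\<Phi>\<^sub>r (x - y)\<close>, which leaves an increment of \<open>\<Phi>\<^sub>r\<close> of size \<open>|y| / x\<^sup>2\<close> uniformly in the
  scale \<open>r\<close>. Near the support the trivial bound by \<open>\<parallel>\<Phi>\<parallel>\<^sub>1\<close> suffices. Together the maximal function is
  dominated by a multiple of \<open>1 / (1 + x\<^sup>2)\<close>.
\<close>
lemma H1_norm_odd_atom_finite:
  assumes "schwartz \<Phi>"
  shows "H1_norm \<Phi> odd_atom < \<infinity>"
proof -
  note \<Phi> = schwartz_imp_averaging_profile[OF assms]
  obtain C where C: "C \<ge> 0" "\<And>u h. \<bar>h\<bar> \<le> \<bar>u\<bar> / 2 \<Longrightarrow> u\<^sup>2 * cmod (\<Phi> (u - h) - \<Phi> u) \<le> C * \<bar>h\<bar>"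
    using schwartz_increment[OF assms] by metis
  define L where "L = (LINT x|lborel. cmod (\<Phi> x))"
  have L: "L \<ge> 0" by (simp add: L_def)
  have near: "cmod (convolve odd_atom (dilate r \<Phi>) x) \<le> L" if r: "r > 0" for r x
  proof -
    note \<Phi>r = averaging_profile_dilate[OF \<Phi> r]
    note [measurable] = averaging_profileD(2)[OF \<Phi>r]
    have "cmod (convolve odd_atom (dilate r \<Phi>) x) \<le> (LINT y|lborel. cmod (dilate r \<Phi> y))"
      unfolding convolve_eq_lborel(1)[OF odd_atom_measurable averaging_profileD(2)[OF \<Phi>r]]
    proof (rule Bochner_Integration.integral_norm_bound_integral)
      have "cmod (odd_atom z) \<le> 1" for z
        using norm_odd_atom_le[of z] by (auto split: split_indicator_asm)
      then show bd: "cmod (odd_atom (x - y) * dilate r \<Phi> y) \<le> cmod (dilate r \<Phi> y)" for y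
        by (simp add: norm_mult mult_left_le_one_le)
      show "integrable lborel (\<lambda>y. cmod (dilate r \<Phi> y))"
        using averaging_profileD(3)[OF \<Phi>r] by simp
      show "integrable lborel (\<lambda>y. odd_atom (x - y) * dilate r \<Phi> y)"
        by (rule Bochner_Integration.integrable_bound[OF averaging_profileD(3)[OF \<Phi>r]]) (use bd in auto)
    qed
    also have "\<dots> = L"
      unfolding L_def using r
      by (subst lborel_integral_real_affine[of r _ 0]) (simp_all add: dilate_def norm_divide)
    finally show ?thesis .
  qed
  have far: "cmod (convolve odd_atom (dilate r \<Phi>) x) \<le> 2 * C / x\<^sup>2" if r: "r > 0" and x: "\<bar>x\<bar> \<ge> 2" for r x
  proof -
    note \<Phi>r = averaging_profile_dilate[OF \<Phi> r]
    note [measurable] = averaging_profileD(2)[OF \<Phi>r]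
    have int: "integrable lborel (\<lambda>y. odd_atom y * dilate r \<Phi> (x - y))"
      by (rule convolution_integrable[OF odd_atom_integrable \<Phi>r])
    have "convolve odd_atom (dilate r \<Phi>) x =
        (LINT y|lborel. odd_atom y * dilate r \<Phi> (x - y)) - (LINT y|lborel. odd_atom y * dilate r \<Phi> x)"
      by (simp add: convolve_eq_lborel(2) integral_odd_atom)
    also have "\<dots> = (LINT y|lborel. odd_atom y * dilate r \<Phi> (x - y) - odd_atom y * dilate r \<Phi> x)"
      using int odd_atom_integrable by (subst Bochner_Integration.integral_diff) simp_all
    also have "cmod \<dots> \<le> (LINT (y::real)|lborel. indicator {-1..1} y * (C / x\<^sup>2))"
    proof (rule Bochner_Integration.integral_norm_bound_integral)
      show "integrable lborel (\<lambda>y. odd_atom y * dilate r \<Phi> (x - y) - odd_atom y * dilate r \<Phi> x)"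
        using int odd_atom_integrable by simp
      show "integrable lborel (\<lambda>y::real. indicator {-1..1} y * (C / x\<^sup>2))" by simp
      fix y :: real
      show "cmod (odd_atom y * dilate r \<Phi> (x - y) - odd_atom y * dilate r \<Phi> x) \<le> indicator {-1..1} y * (C / x\<^sup>2)"
      proof (cases "\<bar>y\<bar> \<le> 1")
        case True
        have "\<bar>y / r\<bar> \<le> \<bar>x / r\<bar> / 2"
          using True x r divide_right_mono[of "\<bar>y\<bar>" "\<bar>x\<bar> / 2" r] by (simp add: mult.commute)
        then have "(x / r)\<^sup>2 * cmod (\<Phi> (x / r - y / r) - \<Phi> (x / r)) \<le> C * \<bar>y / r\<bar>"
          by (rule C(2))
        also have "\<dots> \<le> C * (1 / r)"
          using True r C(1) by (intro mult_left_mono) (simp_all add: divide_right_mono)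
        finally have "cmod (\<Phi> (x / r - y / r) - \<Phi> (x / r)) / r \<le> C / x\<^sup>2"
        proof -
          assume "(x / r)\<^sup>2 * cmod (\<Phi> (x / r - y / r) - \<Phi> (x / r)) \<le> C * (1 / r)" (is "_ * ?\<delta> \<le> _")
          then have "r\<^sup>2 * ((x / r)\<^sup>2 * ?\<delta>) \<le> r\<^sup>2 * (C * (1 / r))"
            by (rule mult_left_mono) simp
          then have "x\<^sup>2 * ?\<delta> \<le> C * r"
            using r by (simp add: power_divide power2_eq_square mult.commute[of r C])
          moreover have "x\<^sup>2 > 0" using x by auto
          ultimately show ?thesis using r by (simp add: pos_divide_le_eq pos_le_divide_eq mult_ac)
        qed
        moreover have "dilate r \<Phi> (x - y) - dilate r \<Phi> x = (\<Phi> (x / r - y / r) - \<Phi> (x / r)) / of_real r"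
          by (simp add: dilate_def diff_divide_distrib)
        ultimately have *: "cmod (dilate r \<Phi> (x - y) - dilate r \<Phi> x) \<le> C / x\<^sup>2"
          using r by (simp add: norm_divide)
        have "cmod (odd_atom y) * cmod (dilate r \<Phi> (x - y) - dilate r \<Phi> x) \<le> indicator {-1..1} y * (C / x\<^sup>2)"
          by (rule mult_mono[OF norm_odd_atom_le *]) auto
        then show ?thesis by (simp add: norm_mult flip: right_diff_distrib)
      next
        case False
        then have "odd_atom y = 0" by (auto simp: odd_atom_def split: split_indicator)
        then show ?thesis using C(1) by simp
      qed
    qed
    also have "\<dots> = 2 * C / x\<^sup>2" by simp
    finally show ?thesis .
  qed
  \<comment> \<open>\<open>1 + x\<^sup>2 \<le> 5\<close> if \<open>|x| \<le> 2\<close>, and \<open>1 + x\<^sup>2 \<le> 2 x\<^sup>2\<close> if \<open>|x| \<ge> 2\<close>; this explains the constants.\<close>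
  have bound: "cmod (convolve odd_atom (dilate r \<Phi>) x) \<le> (5 * L + 4 * C) * inverse (1 + x\<^sup>2)" if r: "r > 0" for r x
  proof (cases "\<bar>x\<bar> \<ge> 2")
    case True
    then have "2\<^sup>2 \<le> \<bar>x\<bar>\<^sup>2" by (intro power_mono) auto
    then have "1 + x\<^sup>2 \<le> 2 * x\<^sup>2" "x\<^sup>2 > 0" by auto
    then have "2 * C / x\<^sup>2 \<le> 4 * C * inverse (1 + x\<^sup>2)"
      using C(1) mult_left_mono[of "1 + x\<^sup>2" "2 * x\<^sup>2" "2 * C"] by (simp add: field_simps)
    also have "\<dots> \<le> (5 * L + 4 * C) * inverse (1 + x\<^sup>2)"
      using L by (intro mult_right_mono) auto
    finally show ?thesis using far[OF r True] by linarith
  next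
    case False
    then have "\<bar>x\<bar>\<^sup>2 \<le> 2\<^sup>2" by (intro power_mono) auto
    then have "1 + x\<^sup>2 \<le> 5" by simp
    then have "L \<le> 5 * L * inverse (1 + x\<^sup>2)"
      using L mult_left_mono[of "1 + x\<^sup>2" 5 L] by (simp add: field_simps add_pos_nonneg)
    also have "\<dots> \<le> (5 * L + 4 * C) * inverse (1 + x\<^sup>2)"
      using C(1) by (intro mult_right_mono) auto
    finally show ?thesis using near[OF r] order_trans by blast
  qed
  have "H1_norm \<Phi> odd_atom \<le> (\<integral>\<^sup>+x. ennreal ((5 * L + 4 * C) * inverse (1 + x\<^sup>2)) \<partial>lborel)"
    unfolding H1_norm_lborel smooth_maximal_def
    by (intro nn_integral_mono SUP_least ennreal_leI bound) simp
  also have "\<dots> < \<infinity>"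
  proof -
    have "integrable lborel (\<lambda>x::real. (5 * L + 4 * C) * inverse (1 + x\<^sup>2))"
      using integrable_inverse_1_plus_square by (simp add: set_integrable_def)
    then have "(\<integral>\<^sup>+x. ennreal (norm ((5 * L + 4 * C) * inverse (1 + x\<^sup>2))) \<partial>lborel) < \<infinity>"
      unfolding integrable_iff_bounded by blast
    moreover have "norm ((5 * L + 4 * C) * inverse (1 + x\<^sup>2)) = (5 * L + 4 * C) * inverse (1 + x\<^sup>2)" for x
      using L C(1) by (simp add: abs_mult)
    ultimately show ?thesis by simp
  qed
  finally show ?thesis .
qed

section \<open>Almost invariant functions\<close>

text \<open>
  The convolutions at small scales converge to \<open>f x\<close> times the integral of \<open>\<Phi>\<close>.
\<close>
lemma smooth_maximal_ge_at_continuity: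
  assumes f: "f \<in> borel_measurable borel" "\<And>x. cmod (f x) \<le> B" "isCont f x"
    and \<Phi>: "averaging_profile \<Phi>"
  shows "ennreal (cmod (f x) * cmod (LINT y|lborel. \<Phi> y)) \<le> smooth_maximal \<Phi> f x"
proof -
  note [measurable] = f(1) averaging_profileD(2)[OF \<Phi>]
  define r where "r n = inverse (real (Suc n))" for n
  have r: "r n > 0" for n by (simp add: r_def)
  have conv: "convolve f (dilate (r n) \<Phi>) x = (LINT y|lborel. f (x - r n * y) * \<Phi> y)" for n
  proof -
    have [measurable]: "dilate (r n) \<Phi> \<in> borel_measurable borel"
      by (rule averaging_profileD(2)[OF averaging_profile_dilate[OF \<Phi> r]])
    have "convolve f (dilate (r n) \<Phi>) x = (LINT y|lborel. f (x - y) * dilate (r n) \<Phi> y)"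
      by (rule convolve_eq_lborel(1)) measurable
    also have "\<dots> = r n *\<^sub>R (LINT y|lborel. f (x - r n * y) * \<Phi> y / of_real (r n))"
      using r[of n] by (subst lborel_integral_real_affine[of "r n" _ 0]) (simp_all add: dilate_def)
    also have "\<dots> = (LINT y|lborel. f (x - r n * y) * \<Phi> y)"
      using r[of n] by (simp add: scaleR_conv_of_real)
    finally show ?thesis .
  qed
  have "(\<lambda>n. LINT y|lborel. f (x - r n * y) * \<Phi> y) \<longlonglongrightarrow> (LINT y|lborel. f x * \<Phi> y)"
  proof (rule integral_dominated_convergence[where w="\<lambda>y. B * cmod (\<Phi> y)"])
    have "r \<longlonglongrightarrow> 0" unfolding r_def by (rule LIMSEQ_inverse_real_of_nat)
    then have "(\<lambda>n. x - r n * y) \<longlonglongrightarrow> x" for y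
      by (auto intro!: tendsto_eq_intros)
    then show "AE y in lborel. (\<lambda>n. f (x - r n * y) * \<Phi> y) \<longlonglongrightarrow> f x * \<Phi> y"
      by (intro AE_I2 tendsto_intros isCont_tendsto_compose[OF f(3)])
    show "AE y in lborel. cmod (f (x - r n * y) * \<Phi> y) \<le> B * cmod (\<Phi> y)" for n
      using f(2) by (auto intro!: AE_I2 simp: norm_mult mult_right_mono)
  qed (use averaging_profileD(3)[OF \<Phi>] in auto)
  then have lim: "(\<lambda>n. ennreal (cmod (convolve f (dilate (r n) \<Phi>) x))) \<longlonglongrightarrow> ennreal (cmod (f x * (LINT y|lborel. \<Phi> y)))"
    unfolding conv by (intro tendsto_ennrealI tendsto_norm) simp
  have le: "ennreal (cmod (convolve f (dilate (r n) \<Phi>) x)) \<le> smooth_maximal \<Phi> f x" for n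
    unfolding smooth_maximal_def using r by (intro SUP_upper) simp
  show ?thesis
    using LIMSEQ_le_const2[OF lim] le unfolding norm_mult by blast
qed

text \<open>
  The indicator of \<open>[1, e\<^sup>n]\<close> times the density of the Haar measure \<open>dt/t\<close> of \<open>(0,\<infinity>)\<close>. Its total mass is
  \<open>n\<close>, which is the reason for the exponential endpoint.
\<close>
definition log_kernel :: "real \<Rightarrow> real \<Rightarrow> complex" where
  "log_kernel n t = of_real (indicator {1..exp n} t / t)"

lemma nn_integral_log_mass:
  assumes "0 < a" "a \<le> b"
  shows "(\<integral>\<^sup>+u. indicator {a..b} u * ennreal (1 / u) \<partial>lborel) = ennreal (ln b - ln a)"
proof -
  have "(\<integral>\<^sup>+u. ennreal (1 / u) * indicator {a..b} u \<partial>lborel) = ennreal (ln b - ln a)"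
    using assms by (intro nn_integral_FTC_Icc) (auto intro!: derivative_eq_intros)
  then show ?thesis by (simp add: mult.commute)
qed

lemma log_kernel_measurable[measurable]: "log_kernel n \<in> borel_measurable borel"
  unfolding log_kernel_def[abs_def] by measurable

lemma norm_log_kernel: "ennreal (cmod (log_kernel n u)) = indicator {1..exp n} u * ennreal (1 / u)"
  by (auto simp: log_kernel_def norm_divide split: split_indicator)

lemma dilation_kernel_log_kernel:
  assumes "n \<ge> 0"
  shows "dilation_kernel (log_kernel n)"
  unfolding dilation_kernel_def integrable_iff_bounded norm_log_kernel
  using assms by (subst nn_integral_log_mass) (auto simp: log_kernel_def)

definition test_fun :: "real \<Rightarrow> real \<Rightarrow> complex" where
  "test_fun n = borel_hausdorff (log_kernel n) odd_atom"

lemma test_fun_integrable: "n \<ge> 0 \<Longrightarrow> integrable lborel (test_fun n)"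
  unfolding test_fun_def
  by (rule borel_hausdorff_integrable(1)[OF odd_atom_integrable dilation_kernel_log_kernel])

lemma test_fun_eq:
  assumes x: "1 < x" "x < exp n"
  shows "test_fun n x = of_real (1 / x - exp (- n))"
proof -
  have "odd_atom (x / t) * (log_kernel n t / of_real t) = of_real (indicator {x..exp n} t *\<^sub>R (1 / t\<^sup>2))" for t
    using x by (auto simp: odd_atom_def log_kernel_def power2_eq_square sgn_if field_simps
        split: split_indicator)
  then have "test_fun n x = of_real (LINT t|lborel. indicator {x..exp n} t *\<^sub>R (1 / t\<^sup>2))"
    unfolding test_fun_def borel_hausdorff_def by (simp only: integral_complex_of_real)
  also have "(LINT t|lborel. indicator {x..exp n} t *\<^sub>R (1 / t\<^sup>2)) = - (1 / exp n) - (- (1 / x))"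
    using x
    by (intro integral_FTC_Icc)
      (auto intro!: derivative_eq_intros continuous_intros simp: power2_eq_square
        simp flip: has_real_derivative_iff_has_vector_derivative)
  finally show ?thesis by (simp add: exp_minus field_simps)
qed

text \<open>
  A crude bound: the integrand is at most \<open>1\<close> and lives on \<open>[1, e\<^sup>n]\<close>. It serves only as the
  boundedness hypothesis in the comparison with the maximal function.
\<close>
lemma test_fun_bounded: "cmod (test_fun n x) \<le> measure lborel {1..exp n}"
proof -
  have "ennreal (cmod (test_fun n x)) \<le> (\<integral>\<^sup>+t. ennreal (cmod (odd_atom (x / t) * (log_kernel n t / of_real t))) \<partial>lborel)"
    unfolding test_fun_def borel_hausdorff_def by (rule norm_integral_le_nn_integral)
  also have "\<dots> \<le> (\<integral>\<^sup>+t. indicator {1..exp n} t \<partial>lborel)"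
  proof (rule nn_integral_mono)
    fix t :: real
    have "cmod (odd_atom (x / t)) \<le> 1"
      using norm_odd_atom_le[of "x / t"] by (auto split: split_indicator_asm)
    moreover have "cmod (log_kernel n t / of_real t) \<le> indicator {1..exp n} t"
      using mult_mono[of 1 "\<bar>t\<bar>" 1 "\<bar>t\<bar>"]
      by (auto simp: log_kernel_def norm_divide norm_mult divide_simps split: split_indicator)
    ultimately have "cmod (odd_atom (x / t) * (log_kernel n t / of_real t)) \<le> 1 * indicator {1..exp n} t"
      unfolding norm_mult by (intro mult_mono) auto
    then have "ennreal (cmod (odd_atom (x / t) * (log_kernel n t / of_real t))) \<le> ennreal (indicator {1..exp n} t)"
      by (intro ennreal_leI) simp
    then show "ennreal (cmod (odd_atom (x / t) * (log_kernel n t / of_real t))) \<le> indicator {1..exp n} t"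
      unfolding ennreal_indicator .
  qed
  also have "\<dots> = ennreal (measure lborel {1..exp n})"
    by (subst emeasure_eq_ennreal_measure[symmetric]) (auto simp: emeasure_lborel_Icc_eq)
  finally show ?thesis by simp
qed

text \<open>
  The maximal function is bounded below by \<open>1/x - e\<^bsup>-n\<^esup>\<close> times \<open>|\<integral> \<Phi>|\<close> on \<open>(1, e\<^sup>n)\<close>, whose integral there is
  \<open>n - 1 + e\<^bsup>-n\<^esup>\<close> times \<open>|\<integral> \<Phi>|\<close>.
\<close>
lemma H1_norm_test_fun_ge:
  assumes n: "n \<ge> 0" and \<Phi>: "averaging_profile \<Phi>"
  shows "ennreal (cmod (LINT y|lborel. \<Phi> y) * (n - 1)) \<le> H1_norm \<Phi> (test_fun n)"
proof -
  define c where "c = cmod (LINT y|lborel. \<Phi> y)"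
  have c: "c \<ge> 0" by (simp add: c_def)
  have pos: "1 / x - exp (- n) \<ge> 0" if "1 \<le> x" "x \<le> exp n" for x
    using that by (simp add: exp_minus field_simps)
  have ptwise: "ennreal (c * (1 / x - exp (- n))) * indicator {1..exp n} x \<le> smooth_maximal \<Phi> (test_fun n) x"
    if x: "x \<noteq> 1" "x \<noteq> exp n" for x
  proof (cases "x \<in> {1..exp n}")
    case True
    then have x': "x \<in> {1<..<exp n}" using x by auto
    have "continuous_on {1<..<exp n} (\<lambda>x. complex_of_real (1 / x - exp (- n)))"
      by (intro continuous_intros) auto
    then have "continuous_on {1<..<exp n} (test_fun n)"
      by (subst continuous_on_cong[OF refl test_fun_eq]) auto
    then have "isCont (test_fun n) x"
      using x' by (simp add: continuous_on_eq_continuous_at)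
    then have "ennreal (cmod (test_fun n x) * c) \<le> smooth_maximal \<Phi> (test_fun n) x"
      unfolding c_def
      using borel_measurable_integrable[OF test_fun_integrable[OF n]]
      by (intro smooth_maximal_ge_at_continuity[OF _ test_fun_bounded _ \<Phi>]) simp_all
    also have "cmod (test_fun n x) = 1 / x - exp (- n)"
      using x' pos[of x] by (subst test_fun_eq) (simp_all only: norm_of_real, auto)
    finally show ?thesis using True by (simp add: mult.commute)
  qed simp
  have "ennreal (c * (n - 1)) \<le> ennreal (c * (ln (exp n) - exp (- n) * exp n) - c * (ln 1 - exp (- n) * 1))"
    using c by (intro ennreal_leI) (simp add: exp_minus algebra_simps)
  also have "\<dots> = (\<integral>\<^sup>+x. ennreal (c * (1 / x - exp (- n))) * indicator {1..exp n} x \<partial>lborel)"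
    using n c pos
    by (intro nn_integral_FTC_Icc[symmetric]) (auto intro!: derivative_eq_intros mult_nonneg_nonneg)
  also have "\<dots> \<le> H1_norm \<Phi> (test_fun n)"
    unfolding H1_norm_lborel
    by (rule nn_integral_mono_AE)
      (use AE_lborel_singleton[of 1] AE_lborel_singleton[of "exp n"] ptwise in auto)
  finally show ?thesis by (simp add: c_def)
qed

text \<open>
  In the logarithmic variable this is the measure of the symmetric difference of an interval of length
  \<open>n\<close> and its translate by \<open>ln t\<close>. That set is covered by the two intervals themselves, and also by two
  intervals of length \<open>|ln t|\<close>, one at each end.
\<close>
lemma log_kernel_translation_defect:
  assumes n: "n \<ge> 0" and t: "t > 0"
  shows "(\<integral>\<^sup>+u. ennreal \<bar>indicator {1..exp n} (u / t) - indicator {1..exp n} u\<bar> * ennreal (1 / u) \<partial>lborel)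
    \<le> ennreal (min (2 * \<bar>ln t\<bar>) (2 * n))"
    (is "?I \<le> _")
proof -
  have ind: "indicator {1..exp n} (u / t) = indicator {t..t * exp n} u" for u
    using t by (auto simp: field_simps split: split_indicator)
  define mass where "mass a b = (\<integral>\<^sup>+u. indicator {a..b} u * ennreal (1 / u) \<partial>lborel)" for a b :: real
  have cover: "?I \<le> mass a b + mass a' b'"
    if "\<And>u. indicator {1..exp n} (u / t) \<noteq> (indicator {1..exp n} u :: real) \<Longrightarrow> u \<in> {a..b} \<union> {a'..b'}" for a b a' b'
  proof -
    have "ennreal \<bar>indicator {1..exp n} (u / t) - indicator {1..exp n} u\<bar> * ennreal (1 / u) \<le>
        indicator {a..b} u * ennreal (1 / u) + indicator {a'..b'} u * ennreal (1 / u)" for u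
      using that[of u]
      by (cases "u \<in> {a..b}"; cases "u \<in> {a'..b'}") (auto split: split_indicator simp: add_increasing)
    then show ?thesis
      unfolding mass_def by (subst nn_integral_add[symmetric]) (auto intro!: nn_integral_mono)
  qed
  have "?I \<le> mass t (t * exp n) + mass 1 (exp n)"
    by (rule cover) (auto simp: ind split: split_indicator_asm)
  also have "\<dots> = ennreal (2 * n)"
    using n t by (simp add: mass_def nn_integral_log_mass ln_mult flip: ennreal_plus)
  finally have 1: "?I \<le> ennreal (2 * n)" .
  have "?I \<le> mass (min 1 t) (max 1 t) + mass (min 1 t * exp n) (max 1 t * exp n)"
  proof (rule cover)
    fix u assume u: "indicator {1..exp n} (u / t) \<noteq> (indicator {1..exp n} u :: real)"
    define s e where "s = t * exp n" and "e = exp n"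
    have "min 1 t * exp n = min e s" "max 1 t * exp n = max e s"
      by (auto simp: s_def e_def min_def max_def)
    moreover have "t \<le> 1 \<longleftrightarrow> s \<le> e" by (simp add: s_def e_def)
    moreover have "(u \<in> {t..s}) \<noteq> (u \<in> {1..e})"
      using u unfolding ind s_def e_def by (auto split: split_indicator_asm)
    ultimately show "u \<in> {min 1 t..max 1 t} \<union> {min 1 t * exp n..max 1 t * exp n}"
      by (auto simp: min_def max_def)
  qed
  also have "mass (min 1 t) (max 1 t) = ennreal \<bar>ln t\<bar>"
    using t unfolding mass_def by (subst nn_integral_log_mass) (auto simp: min_def max_def)
  also have "mass (min 1 t * exp n) (max 1 t * exp n) = ennreal \<bar>ln t\<bar>"
    using t unfolding mass_def by (subst nn_integral_log_mass) (auto simp: min_def max_def ln_mult)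
  also have "ennreal \<bar>ln t\<bar> + ennreal \<bar>ln t\<bar> = ennreal (2 * \<bar>ln t\<bar>)"
    by (simp flip: ennreal_plus)
  finally show ?thesis using 1 by (simp add: min_def)
qed

text \<open>
  \<open>\<theta>(u) = \<integral> \<phi>(t) (\<psi>\<^sub>n(u/t)/t - \<psi>\<^sub>n(u)) dt\<close> averages differences between \<open>\<psi>\<^sub>n\<close> and its dilates, whose \<open>L\<^sup>1\<close>
  norms the preceding lemma bounds.
\<close>
lemma log_kernel_defect:
  assumes \<phi>: "dilation_kernel \<phi>" and n: "n \<ge> 0"
  shows "(\<integral>\<^sup>+u. ennreal (cmod (borel_hausdorff \<phi> (log_kernel n) u - (LINT t|lborel. \<phi> t) * log_kernel n u)) \<partial>lborel)
    \<le> (\<integral>\<^sup>+t. ennreal (cmod (\<phi> t) * min (2 * \<bar>ln t\<bar>) (2 * n)) \<partial>lborel)"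
proof -
  note [measurable] = dilation_kernelD(2)[OF \<phi>]
  define d where "d t u = ennreal \<bar>indicator {1..exp n} (u / t) - indicator {1..exp n} u\<bar> * ennreal (1 / u)" for t u :: real
  have [measurable]: "case_prod d \<in> borel_measurable (borel \<Otimes>\<^sub>M borel)"
    unfolding d_def by measurable
  have "ennreal (cmod (borel_hausdorff \<phi> (log_kernel n) u - (LINT t|lborel. \<phi> t) * log_kernel n u))
      \<le> (\<integral>\<^sup>+t. ennreal (cmod (\<phi> t)) * d t u \<partial>lborel)" (is "ennreal (cmod ?\<theta>) \<le> _") for u
  proof (cases "u > 0")
    case False
    then have "?\<theta> = 0"
      using dilation_kernelD(3)[OF dilation_kernel_borel_hausdorff[OF \<phi> dilation_kernel_log_kernel[OF n]], of u]
        dilation_kernelD(3)[OF dilation_kernel_log_kernel[OF n], of u] by simp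
    then show ?thesis by simp
  next
    case True
    have eq: "log_kernel n (u / t) * (\<phi> t / of_real t) = \<phi> t * of_real (indicator {1..exp n} (u / t) / u)" for t
      using True dilation_kernelD(3)[OF \<phi>, of t] by (cases "t > 0") (simp_all add: log_kernel_def)
    have int: "integrable lborel (\<lambda>t. \<phi> t * of_real (indicator {1..exp n} (u / t) / u))"
    proof (rule Bochner_Integration.integrable_bound)
      show "integrable lborel (\<lambda>t. \<phi> t * of_real (1 / u))"
        using dilation_kernelD(1)[OF \<phi>] by simp
    qed (auto intro!: AE_I2 simp: norm_mult norm_divide split: split_indicator)
    have "?\<theta> = (LINT t|lborel. \<phi> t * of_real (indicator {1..exp n} (u / t) / u)) - (LINT t|lborel. \<phi> t * log_kernel n u)"
      by (simp only: borel_hausdorff_def eq integral_mult_left_zero)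
    also have "\<dots> = (LINT t|lborel. \<phi> t * of_real (indicator {1..exp n} (u / t) / u) - \<phi> t * log_kernel n u)"
      using int dilation_kernelD(1)[OF \<phi>] by (subst Bochner_Integration.integral_diff) simp_all
    also have "\<dots> = (LINT t|lborel. \<phi> t * of_real ((indicator {1..exp n} (u / t) - indicator {1..exp n} u) / u))"
      by (simp add: log_kernel_def diff_divide_distrib right_diff_distrib)
    also have "ennreal (cmod \<dots>) \<le> (\<integral>\<^sup>+t. ennreal (cmod (\<phi> t * of_real ((indicator {1..exp n} (u / t) - indicator {1..exp n} u) / u))) \<partial>lborel)"
      by (rule norm_integral_le_nn_integral)
    also have "\<dots> = (\<integral>\<^sup>+t. ennreal (cmod (\<phi> t)) * d t u \<partial>lborel)"
      using True by (intro nn_integral_cong)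
        (simp only: d_def norm_mult norm_of_real, simp add: abs_divide flip: ennreal_mult)
    finally show ?thesis .
  qed
  then have "(\<integral>\<^sup>+u. ennreal (cmod (borel_hausdorff \<phi> (log_kernel n) u - (LINT t|lborel. \<phi> t) * log_kernel n u)) \<partial>lborel)
      \<le> (\<integral>\<^sup>+u. \<integral>\<^sup>+t. ennreal (cmod (\<phi> t)) * d t u \<partial>lborel \<partial>lborel)"
    by (intro nn_integral_mono)
  also have "\<dots> = (\<integral>\<^sup>+t. \<integral>\<^sup>+u. ennreal (cmod (\<phi> t)) * d t u \<partial>lborel \<partial>lborel)"
    by (rule lborel_pair.Fubini') measurable
  also have "\<dots> \<le> (\<integral>\<^sup>+t. ennreal (cmod (\<phi> t) * min (2 * \<bar>ln t\<bar>) (2 * n)) \<partial>lborel)"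
  proof (rule nn_integral_mono)
    fix t :: real
    have "(\<integral>\<^sup>+u. ennreal (cmod (\<phi> t)) * d t u \<partial>lborel) = ennreal (cmod (\<phi> t)) * (\<integral>\<^sup>+u. d t u \<partial>lborel)"
      by (rule nn_integral_cmult) measurable
    also have "\<dots> \<le> ennreal (cmod (\<phi> t) * min (2 * \<bar>ln t\<bar>) (2 * n))"
    proof (cases "t > 0")
      case True
      then show ?thesis
        using mult_left_mono[OF log_kernel_translation_defect[OF n True], of "ennreal (cmod (\<phi> t))"] n
        by (simp add: d_def ennreal_mult)
    qed (use dilation_kernelD(3)[OF \<phi>, of t] in simp)
    finally show "(\<integral>\<^sup>+u. ennreal (cmod (\<phi> t)) * d t u \<partial>lborel) \<le> ennreal (cmod (\<phi> t) * min (2 * \<bar>ln t\<bar>) (2 * n))" .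
  qed
  finally show ?thesis .
qed

text \<open>
  The truncation by \<open>2 n\<close> provides the integrable majorant \<open>2 |\<phi>|\<close>; without it one would have to assume
  that \<open>\<phi>(t) ln t\<close> is integrable.
\<close>
lemma log_kernel_defect_sublinear:
  assumes \<phi>: "dilation_kernel \<phi>"
  shows "(\<lambda>n. (LINT t|lborel. cmod (\<phi> t) * min (2 * \<bar>ln t\<bar>) (2 * real n)) / real n) \<longlonglongrightarrow> 0"
proof -
  note [measurable] = dilation_kernelD(2)[OF \<phi>]
  have "(\<lambda>n. LINT t|lborel. cmod (\<phi> t) * min (2 * \<bar>ln t\<bar>) (2 * real n) / real n) \<longlonglongrightarrow> (LINT (t::real)|lborel. 0 :: real)"
  proof (rule integral_dominated_convergence[where w="\<lambda>t. 2 * cmod (\<phi> t)"])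
    have "(\<lambda>n. min (2 * \<bar>ln t\<bar>) (2 * real n) / real n) \<longlonglongrightarrow> 0" for t :: real
    proof (rule tendsto_sandwich[of "\<lambda>_. 0" _ _ "\<lambda>n. 2 * \<bar>ln t\<bar> / real n"])
      show "(\<lambda>n. 2 * \<bar>ln t\<bar> / real n) \<longlonglongrightarrow> 0" by (rule lim_const_over_n)
    qed (auto intro!: always_eventually divide_right_mono)
    then show "AE t in lborel. (\<lambda>n. cmod (\<phi> t) * min (2 * \<bar>ln t\<bar>) (2 * real n) / real n) \<longlonglongrightarrow> 0"
      by (intro AE_I2) (auto intro!: tendsto_mult_right_zero simp flip: times_divide_eq_right)
    have *: "min (2 * \<bar>ln t\<bar>) (2 * real n) / real n \<le> 2" for t and n :: nat
      by (cases "n = 0") (auto simp: field_simps min_def)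
    show "AE t in lborel. norm (cmod (\<phi> t) * min (2 * \<bar>ln t\<bar>) (2 * real n) / real n) \<le> 2 * cmod (\<phi> t)" for n
      using mult_left_mono[OF *, of "cmod (\<phi> t)" for t]
      by (auto intro!: AE_I2 simp: abs_mult mult.commute[of 2])
  qed (use dilation_kernelD(1)[OF \<phi>] in auto)
  then show ?thesis by simp
qed

section \<open>The lower bound and the operator norm\<close>

lemma H1_norm_test_fun_finite:
  assumes "schwartz \<Phi>" and n: "n \<ge> 0"
  shows "H1_norm \<Phi> (test_fun n) < \<infinity>"
proof -
  have "H1_norm \<Phi> (test_fun n) \<le> (\<integral>\<^sup>+t. ennreal (cmod (log_kernel n t)) \<partial>lborel) * H1_norm \<Phi> odd_atom"
    unfolding test_fun_def
    by (rule H1_norm_borel_hausdorff_le[OF odd_atom_integrable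
        schwartz_imp_averaging_profile[OF assms(1)] dilation_kernel_log_kernel[OF n]])
  also have "\<dots> < \<infinity>"
    using dilation_kernelD(4)[OF dilation_kernel_log_kernel[OF n]] H1_norm_odd_atom_finite[OF assms(1)]
    by (simp add: ennreal_mult_less_top)
  finally show ?thesis .
qed

text \<open>
  Otherwise the inequality \<open>|I| \<parallel>f\<^sub>n\<parallel> \<le> N \<parallel>f\<^sub>n\<parallel> + o(n)\<close> would contradict the linear growth of \<open>\<parallel>f\<^sub>n\<parallel>\<close>.
\<close>
lemma norm_integral_kernel_le:
  assumes schwartz: "schwartz \<Phi>" and nz: "(LINT x|lborel. \<Phi> x) \<noteq> 0"
    and \<phi>: "dilation_kernel \<phi>" and N: "N \<ge> 0"
    and bound: "\<And>n. n \<ge> 0 \<Longrightarrow> H1_norm \<Phi> (borel_hausdorff \<phi> (test_fun n)) \<le> ennreal N * H1_norm \<Phi> (test_fun n)"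
  shows "cmod (LINT t|lborel. \<phi> t) \<le> N"
proof (rule ccontr)
  note \<Phi> = schwartz_imp_averaging_profile[OF schwartz]
  note [measurable] = dilation_kernelD(2)[OF \<phi>]
  define I where "I = (LINT t|lborel. \<phi> t)"
  define c where "c = cmod (LINT x|lborel. \<Phi> x)"
  define A where "A = enn2real (H1_norm \<Phi> odd_atom)"
  define F where "F n = enn2real (H1_norm \<Phi> (test_fun n))" for n
  define E where "E n = (LINT t|lborel. cmod (\<phi> t) * min (2 * \<bar>ln t\<bar>) (2 * n))" for n
  assume "\<not> cmod (LINT t|lborel. \<phi> t) \<le> N"
  then have gt: "cmod I > N" by (simp add: I_def)
  have c: "c > 0" using nz by (simp add: c_def)
  have A: "H1_norm \<Phi> odd_atom = ennreal A"
    using H1_norm_odd_atom_finite[OF schwartz] by (simp add: A_def)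
  have F: "H1_norm \<Phi> (test_fun n) = ennreal (F n)" if n: "n \<ge> 0" for n
    using H1_norm_test_fun_finite[OF schwartz n] by (simp add: F_def)
  have E: "(\<integral>\<^sup>+t. ennreal (cmod (\<phi> t) * min (2 * \<bar>ln t\<bar>) (2 * n)) \<partial>lborel) = ennreal (E n)"
    "E n \<ge> 0" if n: "n \<ge> 0" for n
  proof -
    have *: "integrable lborel (\<lambda>t. cmod (\<phi> t) * min (2 * \<bar>ln t\<bar>) (2 * n))"
    proof (rule Bochner_Integration.integrable_bound)
      show "integrable lborel (\<lambda>t. cmod (\<phi> t) * (2 * n))"
        using dilation_kernelD(1)[OF \<phi>] by simp
    qed (use n in \<open>auto intro!: AE_I2 mult_left_mono simp: abs_mult\<close>)
    show "(\<integral>\<^sup>+t. ennreal (cmod (\<phi> t) * min (2 * \<bar>ln t\<bar>) (2 * n)) \<partial>lborel) = ennreal (E n)"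
      unfolding E_def by (rule nn_integral_eq_integral[OF *]) (use n in auto)
    show "E n \<ge> 0" unfolding E_def using n by (intro integral_nonneg_AE) auto
  qed
  have key: "cmod I * F n \<le> N * F n + E n * A" if n: "n \<ge> 0" for n
  proof -
    note f = test_fun_integrable[OF n]
    define \<theta> where "\<theta> u = borel_hausdorff \<phi> (log_kernel n) u - I * log_kernel n u" for u
    note \<theta> = borel_hausdorff_defect[OF odd_atom_integrable \<phi> dilation_kernel_log_kernel[OF n], of I,
        folded \<theta>_def test_fun_def]
    define w where "w x = borel_hausdorff \<phi> (test_fun n) x - I * test_fun n x" for x
    have w: "integrable lborel w"
      unfolding w_def using f borel_hausdorff_integrable(1)[OF f \<phi>] by simp
    have "ennreal (cmod I) * H1_norm \<Phi> (test_fun n) = H1_norm \<Phi> (\<lambda>x. I * test_fun n x)"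
      by (rule H1_norm_cmult[OF f \<Phi>, symmetric])
    also have "(\<lambda>x. I * test_fun n x) = (\<lambda>x. borel_hausdorff \<phi> (test_fun n) x + (- 1) * w x)"
      by (simp add: w_def)
    also have "H1_norm \<Phi> \<dots> \<le> H1_norm \<Phi> (borel_hausdorff \<phi> (test_fun n)) + H1_norm \<Phi> (\<lambda>x. (- 1) * w x)"
      using w by (intro H1_norm_triangle borel_hausdorff_integrable(1) f \<phi> \<Phi>) simp
    also have "H1_norm \<Phi> (\<lambda>x. (- 1) * w x) = H1_norm \<Phi> w"
      by (subst H1_norm_cmult[OF w \<Phi>]) simp
    also have "H1_norm \<Phi> w = H1_norm \<Phi> (borel_hausdorff \<theta> odd_atom)"
      using \<theta>(2) borel_measurable_integrable[OF borel_hausdorff_integrable(1)[OF odd_atom_integrable \<theta>(1)]]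
      by (intro H1_norm_cong_AE[OF _ \<Phi>]) (simp_all add: w_def)
    also have "\<dots> \<le> (\<integral>\<^sup>+u. ennreal (cmod (\<theta> u)) \<partial>lborel) * H1_norm \<Phi> odd_atom"
      by (rule H1_norm_borel_hausdorff_le[OF odd_atom_integrable \<Phi> \<theta>(1)])
    also have "\<dots> \<le> ennreal (E n) * ennreal A"
      using log_kernel_defect[OF \<phi> n] unfolding E(1)[OF n] A \<theta>_def I_def by (rule mult_right_mono) simp
    also have "H1_norm \<Phi> (borel_hausdorff \<phi> (test_fun n)) \<le> ennreal N * ennreal (F n)"
      using bound[OF n] unfolding F[OF n] .
    finally have "ennreal (cmod I) * ennreal (F n) \<le> ennreal N * ennreal (F n) + ennreal (E n) * ennreal A"
      unfolding F[OF n] by (simp add: add_mono)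
    then have "ennreal (cmod I * F n) \<le> ennreal (N * F n + E n * A)"
      using N E(2)[OF n] by (simp add: ennreal_mult F_def A_def ennreal_plus)
    then show ?thesis
      using N E(2)[OF n] by (subst (asm) ennreal_le_iff) (auto simp: F_def A_def)
  qed
  have growth: "c * (n - 1) \<le> F n" if "n \<ge> 0" for n
    using H1_norm_test_fun_ge[OF that \<Phi>] unfolding F[OF that] c_def
    by (subst (asm) ennreal_le_iff) (auto simp: F_def)
  have "(cmod I - N) * (c * (1 - 1 / real n)) \<le> E (real n) / real n * A" if "n \<ge> 1" for n :: nat
  proof -
    have "(cmod I - N) * (c * (real n - 1)) \<le> (cmod I - N) * F (real n)"
      using gt growth[of "real n"] by (intro mult_left_mono) auto
    also have "\<dots> \<le> E (real n) * A" using key[of "real n"] by (simp add: algebra_simps)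
    finally have "(cmod I - N) * (c * (real n - 1)) / real n \<le> E (real n) * A / real n"
      by (rule divide_right_mono) simp
    then show ?thesis using that by (simp add: field_simps)
  qed
  moreover have "(\<lambda>n. E (real n) / real n * A) \<longlonglongrightarrow> 0 * A"
    unfolding E_def by (intro tendsto_mult log_kernel_defect_sublinear[OF \<phi>] tendsto_const)
  moreover have "(\<lambda>n. (cmod I - N) * (c * (1 - 1 / real n))) \<longlonglongrightarrow> (cmod I - N) * (c * (1 - 0))"
    by (intro tendsto_intros lim_const_over_n)
  ultimately have "(cmod I - N) * (c * (1 - 0)) \<le> 0 * A"
    by (intro LIMSEQ_le) auto
  then show False using gt c by (simp add: mult_le_0_iff)
qed

text \<open>
  Extending \<open>\<phi>\<close> by zero and passing to a Borel representative changes neither of the two integrals that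
  bound the operator norm.
\<close>
lemma hausdorff_op_borel_form:
  assumes "set_integrable lebesgue {0<..} \<phi>"
  obtains \<psi> where "dilation_kernel \<psi>" "AE t in lborel. indicator {0<..} t *\<^sub>R \<phi> t = \<psi> t"
    "(LINT t:{0<..}|lebesgue. \<phi> t) = (LINT t|lborel. \<psi> t)"
    "ennreal (LINT t:{0<..}|lebesgue. cmod (\<phi> t)) = (\<integral>\<^sup>+t. ennreal (cmod (\<psi> t)) \<partial>lborel)"
proof -
  obtain \<psi>\<^sub>0 where \<psi>\<^sub>0: "integrable lborel \<psi>\<^sub>0" "AE t in lborel. indicator {0<..} t *\<^sub>R \<phi> t = \<psi>\<^sub>0 t"
    using integrable_borel_representative[OF assms[unfolded set_integrable_def]] .
  define \<psi> where "\<psi> t = indicator {0<..} t *\<^sub>R \<psi>\<^sub>0 t" for t :: real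
  have \<psi>: "dilation_kernel \<psi>"
    unfolding dilation_kernel_def \<psi>_def using \<psi>\<^sub>0(1) by (auto intro!: integrable_mult_indicator)
  note [measurable] = dilation_kernelD(2)[OF \<psi>]
  have ae: "AE t in lborel. indicator {0<..} t *\<^sub>R \<phi> t = \<psi> t"
    using \<psi>\<^sub>0(2) by eventually_elim (auto simp: \<psi>_def split: split_indicator split_indicator_asm)
  show thesis
  proof (rule that[OF \<psi> ae])
    show "(LINT t:{0<..}|lebesgue. \<phi> t) = (LINT t|lborel. \<psi> t)"
      unfolding set_lebesgue_integral_def using ae by (intro lebesgue_integral_AE_borel(1)) simp_all
    have "AE t in lborel. indicator {0<..} t *\<^sub>R cmod (\<phi> t) = cmod (\<psi> t)"
      using ae by eventually_elim (auto split: split_indicator_asm)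
    then have "(LINT t:{0<..}|lebesgue. cmod (\<phi> t)) = (LINT t|lborel. cmod (\<psi> t))"
      unfolding set_lebesgue_integral_def by (intro lebesgue_integral_AE_borel(1)) simp_all
    then show "ennreal (LINT t:{0<..}|lebesgue. cmod (\<phi> t)) = (\<integral>\<^sup>+t. ennreal (cmod (\<psi> t)) \<partial>lborel)"
      using dilation_kernelD(1)[OF \<psi>] by (simp add: nn_integral_eq_integral)
  qed
qed

theorem corollary1p1:
  fixes \<Phi> \<phi> :: "real \<Rightarrow> complex"
  assumes "schwartz \<Phi>"
    and "(LINT x|lebesgue. \<Phi> x) \<noteq> 0"
    and "set_integrable lebesgue {0<..} \<phi>"
  shows "bounded_on_H1 \<Phi> (hausdorff_op \<phi>) \<and>
    ennreal (cmod (LINT t:{0<..}|lebesgue. \<phi> t)) \<le> H1_opnorm \<Phi> (hausdorff_op \<phi>) \<and>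
    H1_opnorm \<Phi> (hausdorff_op \<phi>) \<le> ennreal (LINT t:{0<..}|lebesgue. cmod (\<phi> t))"
proof -
  note \<Phi> = schwartz_imp_averaging_profile[OF assms(1)]
  obtain \<psi> where \<psi>: "dilation_kernel \<psi>" and ae: "AE t in lborel. indicator {0<..} t *\<^sub>R \<phi> t = \<psi> t"
    and int: "(LINT t:{0<..}|lebesgue. \<phi> t) = (LINT t|lborel. \<psi> t)"
    and norm: "ennreal (LINT t:{0<..}|lebesgue. cmod (\<phi> t)) = (\<integral>\<^sup>+t. ennreal (cmod (\<psi> t)) \<partial>lborel)"
    using hausdorff_op_borel_form[OF assms(3)] .
  define K where "K = (LINT t:{0<..}|lebesgue. cmod (\<phi> t))"
  have K0: "K \<ge> 0" unfolding K_def set_lebesgue_integral_def by (intro integral_nonneg_AE) auto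
  have T: "AE x in lborel. hausdorff_op \<phi> f x = borel_hausdorff \<psi> g x"
    if "integrable lborel g" "AE x in lborel. f x = g x" for f g
    by (rule hausdorff_op_eq_borel_hausdorff[OF that \<psi> ae])
  have T_norm: "H1_norm \<Phi> (hausdorff_op \<phi> f) = H1_norm \<Phi> (borel_hausdorff \<psi> g)"
    if "integrable lborel g" "AE x in lborel. f x = g x" for f g
    using borel_measurable_integrable[OF borel_hausdorff_integrable(1)[OF that(1) \<psi>]]
    by (intro H1_norm_cong_AE[OF _ \<Phi> T[OF that]]) simp
  have norm_cong: "H1_norm \<Phi> f = H1_norm \<Phi> g"
    if "integrable lborel g" "AE x in lborel. f x = g x" for f g
    using borel_measurable_integrable[OF that(1)] by (intro H1_norm_cong_AE[OF _ \<Phi> that(2)]) simp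
  have bound: "H1_norm \<Phi> (hausdorff_op \<phi> f) \<le> ennreal K * H1_norm \<Phi> f" if f: "f \<in> H1 \<Phi>" for f
  proof -
    obtain g where g: "integrable lborel g" "AE x in lborel. f x = g x"
      using integrable_borel_representative f unfolding H1_def by blast
    show ?thesis
      unfolding T_norm[OF g] norm_cong[OF g] K_def norm by (rule H1_norm_borel_hausdorff_le[OF g(1) \<Phi> \<psi>])
  qed
  have "bounded_on_H1 \<Phi> (hausdorff_op \<phi>)"
    unfolding bounded_on_H1_def
  proof (intro conjI ballI allI)
    fix f assume f: "f \<in> H1 \<Phi>"
    then obtain f' where f': "integrable lborel f'" "AE x in lborel. f x = f' x"
      using integrable_borel_representative unfolding H1_def by blast
    note Tf_int = borel_hausdorff_integrable(1)[OF f'(1) \<psi>]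
    have "integrable lebesgue (hausdorff_op \<phi> f)"
      using lebesgue_integral_AE_borel(2)[OF _ T[OF f']] Tf_int borel_measurable_integrable[OF Tf_int] by simp
    moreover have "H1_norm \<Phi> (hausdorff_op \<phi> f) < \<infinity>"
      using bound[OF f] f by (simp add: H1_def ennreal_mult_less_top le_less_trans)
    ultimately show "hausdorff_op \<phi> f \<in> H1 \<Phi>" by (simp add: H1_def)
    fix g assume "g \<in> H1 \<Phi>"
    then obtain g' where g': "integrable lborel g'" "AE x in lborel. g x = g' x"
      using integrable_borel_representative unfolding H1_def by blast
    have "AE x in lborel. f x + g x = f' x + g' x"
      using f'(2) g'(2) by eventually_elim simp
    then have "AE x in lborel. hausdorff_op \<phi> (\<lambda>y. f y + g y) x = borel_hausdorff \<psi> (\<lambda>y. f' y + g' y) x"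
      using f'(1) g'(1) by (intro T) auto
    then have "AE x in lborel. hausdorff_op \<phi> (\<lambda>y. f y + g y) x = hausdorff_op \<phi> f x + hausdorff_op \<phi> g x"
      using T[OF f'] T[OF g'] borel_hausdorff_add[OF \<psi> f'(1) g'(1)] by eventually_elim simp
    then show "AE x in lebesgue. hausdorff_op \<phi> (\<lambda>y. f y + g y) x = hausdorff_op \<phi> f x + hausdorff_op \<phi> g x"
      by (rule AE_completion)
  next
    fix c f
    show "AE x in lebesgue. hausdorff_op \<phi> (\<lambda>y. c * f y) x = c * hausdorff_op \<phi> f x"
      by (simp add: hausdorff_op_def set_lebesgue_integral_def mult.assoc flip: integral_mult_right_zero)
  next
    show "\<exists>C::real. C \<ge> 0 \<and> (\<forall>f\<in>H1 \<Phi>. H1_norm \<Phi> (hausdorff_op \<phi> f) \<le> ennreal C * H1_norm \<Phi> f)"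
      using K0 bound by blast
  qed
  moreover have upper: "H1_opnorm \<Phi> (hausdorff_op \<phi>) \<le> ennreal K"
    unfolding H1_opnorm_def
  proof (rule SUP_least)
    fix f assume f: "f \<in> {f \<in> H1 \<Phi>. H1_norm \<Phi> f \<le> 1}"
    then have "H1_norm \<Phi> (hausdorff_op \<phi> f) \<le> ennreal K * H1_norm \<Phi> f" by (simp add: bound)
    also have "\<dots> \<le> ennreal K * 1" using f by (intro mult_left_mono) auto
    finally show "H1_norm \<Phi> (hausdorff_op \<phi> f) \<le> ennreal K" by simp
  qed
  moreover have "ennreal (cmod (LINT t:{0<..}|lebesgue. \<phi> t)) \<le> H1_opnorm \<Phi> (hausdorff_op \<phi>)"
  proof -
    define N where "N = enn2real (H1_opnorm \<Phi> (hausdorff_op \<phi>))"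
    have N: "H1_opnorm \<Phi> (hausdorff_op \<phi>) = ennreal N"
      using le_less_trans[OF upper ennreal_less_top] by (simp add: N_def)
    have "cmod (LINT t|lborel. \<psi> t) \<le> N"
    proof (rule norm_integral_kernel_le[OF assms(1) _ \<psi>])
      have "(LINT x|lebesgue. \<Phi> x) = (LINT x|lborel. \<Phi> x)"
        using averaging_profileD(2)[OF \<Phi>] by (intro lebesgue_integral_AE_borel(1)) auto
      then show "(LINT x|lborel. \<Phi> x) \<noteq> 0" using assms(2) by simp
      show "N \<ge> 0" by (simp add: N_def)
      fix n :: real assume n: "n \<ge> 0"
      note f = test_fun_integrable[OF n]
      define F where "F = enn2real (H1_norm \<Phi> (test_fun n))"
      have F: "H1_norm \<Phi> (test_fun n) = ennreal F"
        using H1_norm_test_fun_finite[OF assms(1) n] by (simp add: F_def)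
      show "H1_norm \<Phi> (borel_hausdorff \<psi> (test_fun n)) \<le> ennreal N * H1_norm \<Phi> (test_fun n)"
      proof (cases "F = 0")
        case True
        then have "H1_norm \<Phi> (borel_hausdorff \<psi> (test_fun n)) \<le> 0"
          using H1_norm_borel_hausdorff_le[OF f \<Phi> \<psi>] F by simp
        then show ?thesis by simp
      next
        case False
        then have Fpos: "F > 0" by (simp add: F_def less_le)
        \<comment> \<open>The operator norm is a supremum over the unit ball, so the test function is normalised first.\<close>
        define g where "g x = of_real (1 / F) * test_fun n x" for x
        have g: "integrable lborel g" unfolding g_def using f by simp
        have "H1_norm \<Phi> g = 1"
          unfolding g_def H1_norm_cmult[OF f \<Phi>] F using Fpos by (simp add: norm_divide flip: ennreal_mult)
        then have "g \<in> {f \<in> H1 \<Phi>. H1_norm \<Phi> f \<le> 1}"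
          using g borel_measurable_integrable[OF g] by (simp add: H1_def integrable_completion)
        then have "H1_norm \<Phi> (hausdorff_op \<phi> g) \<le> H1_opnorm \<Phi> (hausdorff_op \<phi>)"
          unfolding H1_opnorm_def by (rule SUP_upper)
        also have "H1_norm \<Phi> (hausdorff_op \<phi> g) = H1_norm \<Phi> (borel_hausdorff \<psi> g)"
          by (rule T_norm[OF g]) simp
        also have "borel_hausdorff \<psi> g = (\<lambda>x. of_real (1 / F) * borel_hausdorff \<psi> (test_fun n) x)"
          by (simp add: borel_hausdorff_def g_def mult.assoc fun_eq_iff del: of_real_divide times_divide_eq_right
              flip: integral_mult_right_zero)
        also have "H1_norm \<Phi> \<dots> = ennreal (1 / F) * H1_norm \<Phi> (borel_hausdorff \<psi> (test_fun n))"
          using Fpos by (subst H1_norm_cmult[OF borel_hausdorff_integrable(1)[OF f \<psi>] \<Phi>]) (simp add: norm_divide)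
        finally have "ennreal F * (ennreal (1 / F) * H1_norm \<Phi> (borel_hausdorff \<psi> (test_fun n))) \<le> ennreal F * ennreal N"
          unfolding N by (rule mult_left_mono) simp
        also have "ennreal F * (ennreal (1 / F) * H1_norm \<Phi> (borel_hausdorff \<psi> (test_fun n))) =
            ennreal (F * (1 / F)) * H1_norm \<Phi> (borel_hausdorff \<psi> (test_fun n))"
          using Fpos by (subst ennreal_mult) (simp_all add: mult.assoc)
        finally show ?thesis using Fpos by (simp add: F mult.commute)
      qed
    qed
    then show ?thesis unfolding int N by (rule ennreal_leI)
  qed
  ultimately show ?thesis unfolding K_def by blast
qed

end
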